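(* For every formally self-adjoint $Q\in\mathrm{Diff}^1(\mathbb{R})$ and every $N\in\mathbb{N}$ there is a constant $C_N$ such that for all $\rho>1$, any non-trivial solution $u$ (not necessarily in $L^2(\mathbb{R})$) of $$-u''+Qu=\rho^2u\quad\text{on }\mathbb{R},$$ and any $a,b\in\mathbb{R}$ with $|b-a|\le\rho^N$, we have $$\frac{ED(u;b)}{ED(u;a)}<1+C_N\rho^{-1},\qquad\text{where } ED(u;x):=|u(x)|^2+\rho^{-2}|u'(x)|^2 .$$
   Context: $D=-i\partial_x$. $\mathrm{Diff}^1(\mathbb{R})$ is the space of differential operators $Qu=a_1(x)Du+a_0(x)u$ whose coefficients $a_0,a_1$ are smooth and bounded on $\mathbb{R}$ together with all their derivatives. $Q$ is formally self-adjoint if it is symmetric on $C_c^\infty(\mathbb{R})$ with respect to the $L^2(\mathbb{R})$ inner product. *)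

theory Defs
  imports "HOL-Analysis.Analysis"
begin

abbreviation ddx :: "(real \<Rightarrow> complex) \<Rightarrow> real \<Rightarrow> complex" where
  "ddx f \<equiv> (\<lambda>x. vector_derivative f (at x))"

definition smooth :: "(real \<Rightarrow> complex) \<Rightarrow> bool" where
  "smooth f \<longleftrightarrow> (\<forall>k x. (ddx ^^ k) f differentiable (at x))"

definition smooth_bounded :: "(real \<Rightarrow> complex) \<Rightarrow> bool" where
  "smooth_bounded f \<longleftrightarrow> smooth f \<and> (\<forall>k. bounded (range ((ddx ^^ k) f)))"

definition test_function :: "(real \<Rightarrow> complex) \<Rightarrow> bool" where
  "test_function f \<longleftrightarrow> smooth f \<and> compact (closure {x. f x \<noteq> 0})"

definition D_op :: "(real \<Rightarrow> complex) \<Rightarrow> real \<Rightarrow> complex" where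
  "D_op u = (\<lambda>x. - \<i> * ddx u x)"

(* Operators are total maps on all functions real => complex; the value of an operator at a
   function is only meaningful where that function is differentiable. *)
definition Diff1 :: "((real \<Rightarrow> complex) \<Rightarrow> real \<Rightarrow> complex) set" where
  "Diff1 = {Q. \<exists>a\<^sub>1 a\<^sub>0. smooth_bounded a\<^sub>1 \<and> smooth_bounded a\<^sub>0 \<and>
                 Q = (\<lambda>u x. a\<^sub>1 x * D_op u x + a\<^sub>0 x * u x)}"

definition L2_inner :: "(real \<Rightarrow> complex) \<Rightarrow> (real \<Rightarrow> complex) \<Rightarrow> complex" where
  "L2_inner f g = (LINT x|lborel. f x * cnj (g x))"

definition formally_self_adjoint :: "((real \<Rightarrow> complex) \<Rightarrow> real \<Rightarrow> complex) \<Rightarrow> bool" where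
  "formally_self_adjoint Q \<longleftrightarrow>
     (\<forall>\<phi> \<psi>. test_function \<phi> \<and> test_function \<psi> \<longrightarrow> L2_inner (Q \<phi>) \<psi> = L2_inner \<phi> (Q \<psi>))"

(* Classical solutions. Only twice differentiability is required: for Q in Diff1 the equation
   itself then forces u to be smooth. *)
definition solves :: "((real \<Rightarrow> complex) \<Rightarrow> real \<Rightarrow> complex) \<Rightarrow> real \<Rightarrow> (real \<Rightarrow> complex) \<Rightarrow> bool" where
  "solves Q \<rho> u \<longleftrightarrow>
     (\<forall>x. u differentiable (at x) \<and> ddx u differentiable (at x) \<and>
          - ddx (ddx u) x + Q u x = complex_of_real (\<rho>\<^sup>2) * u x)"

definition ED :: "real \<Rightarrow> (real \<Rightarrow> complex) \<Rightarrow> real \<Rightarrow> real" where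
  "ED \<rho> u x = (norm (u x))\<^sup>2 + \<rho> powi (-2) * (norm (ddx u x))\<^sup>2"

end

theory Submission
  imports Defs
begin

text \<open>
  Write \<open>Q = a\<^sub>1 D + a\<^sub>0\<close>. Formal self-adjointness forces \<open>a\<^sub>1\<close> to be real and
  \<open>Im a\<^sub>0 = - a\<^sub>1'/2\<close> (lemma \<open>self_adjoint_coefficients\<close>, tested on bump functions). With
  \<open>A = a\<^sub>1/2\<close>, \<open>W = Re a\<^sub>0 - A\<^sup>2\<close> and the covariant derivative \<open>w = u' + \<i> A u\<close>, the equation becomes
  \<open>w' + \<i> A w = (W - \<rho>\<^sup>2) u\<close>. So, up to a gauge transformation, \<open>u\<close> solves a Schroedinger equation
  with a real bounded potential \<open>W\<close>, and replacing \<open>u'\<close> by \<open>w\<close> changes the energy only by a factor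
  \<open>1 + O(1/\<rho>)\<close> (lemma \<open>energy_shift_le\<close>).

  The energy itself has a logarithmic derivative of size \<open>1/\<rho>\<close>, which is useless over a
  distance \<open>\<rho> ^ N\<close>. The remedy is a corrected quadratic form
  \<open>E = g |w|\<^sup>2 - g' Re (cnj u w) + d |u|\<^sup>2\<close>, where \<open>g = 1 + O(1/\<rho>\<^sup>2)\<close> is an approximate
  solution, to an arbitrarily high order in \<open>1/\<rho>\<close>, of the equation satisfied by products of two
  solutions (lemmas \<open>approximate_amplitude\<close> and \<open>almost_invariant_form\<close>). Such a form is conserved up to
  a relative error \<open>O(1/\<rho>\<^sup>N\<^sup>+\<^sup>1)\<close> per unit length, whence it changes by a factor \<open>1 + O(1/\<rho>)\<close>
  over the whole interval; and \<open>E/\<rho>\<^sup>2\<close> agrees with the energy up to such a factor. This is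
  lemma \<open>covariant_energy_bound\<close>, where bounded values of \<open>\<rho>\<close> are treated by a crude estimate.
\<close>

section \<open>Families of smooth functions\<close>

text \<open>
  Smoothness is handled relative to a set \<open>A\<close> of families of functions on the line: a family
  belongs to \<open>derivs_in n A\<close> if it and its derivatives up to order \<open>n\<close> lie in \<open>A\<close>. Taking all
  families for \<open>A\<close> gives ordinary smoothness; taking the uniformly bounded ones gives symbol-type
  bounds that are uniform in a parameter. If \<open>A\<close> is closed under sums and products, then so is
  the class of families that stay in \<open>A\<close> under all derivatives, by the Leibniz rule.
\<close>

primrec derivs_in :: "nat \<Rightarrow> ('i \<Rightarrow> real \<Rightarrow> 'a::real_normed_field) set \<Rightarrow> ('i \<Rightarrow> real \<Rightarrow> 'a) set" where
  "derivs_in 0 A = A"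
| "derivs_in (Suc n) A =
     {g \<in> A. \<exists>g'\<in>derivs_in n A. \<forall>i x. (g i has_vector_derivative g' i x) (at x)}"

definition Cinf :: "('i \<Rightarrow> real \<Rightarrow> 'a::real_normed_field) set \<Rightarrow> ('i \<Rightarrow> real \<Rightarrow> 'a) set" where
  "Cinf A = (\<Inter>n. derivs_in n A)"

lemma derivs_in_mem: "g \<in> derivs_in n A \<Longrightarrow> g \<in> A"
  by (cases n) auto

lemma derivs_in_Suc_mono: "g \<in> derivs_in (Suc n) A \<Longrightarrow> g \<in> derivs_in n A"
proof (induction n arbitrary: g)
  case (Suc n)
  then obtain g' where "g' \<in> derivs_in (Suc n) A"
    "\<forall>i x. (g i has_vector_derivative g' i x) (at x)" "g \<in> A" by auto
  with Suc.IH show ?case by auto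
qed simp

lemma Cinf_mem: "g \<in> Cinf A \<Longrightarrow> g \<in> A"
  unfolding Cinf_def using derivs_in_mem by blast

text \<open>
  The derivative furnished by each order could a priori depend on the order; uniqueness of
  derivatives makes it a single function, which therefore has derivatives of all orders in \<open>A\<close>.
\<close>

lemma Cinf_deriv:
  assumes "g \<in> Cinf A"
  obtains g' where "g' \<in> Cinf A" "\<And>i x. (g i has_vector_derivative g' i x) (at x)"
proof -
  define g' where "g' = (\<lambda>i x. vector_derivative (g i) (at x))"
  have *: "g' \<in> derivs_in n A \<and> (\<forall>i x. (g i has_vector_derivative g' i x) (at x))" for n
  proof -
    from assms have "g \<in> derivs_in (Suc n) A" unfolding Cinf_def by blast
    then obtain h where h: "h \<in> derivs_in n A"
      "\<forall>i x. (g i has_vector_derivative h i x) (at x)" by auto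
    then have "h = g'" unfolding g'_def by (intro ext) (metis vector_derivative_at)
    with h show ?thesis by simp
  qed
  show ?thesis by (rule that[of g']) (use * in \<open>auto simp: Cinf_def\<close>)
qed

lemma Cinf_const:
  assumes "(\<lambda>i x. c i) \<in> A" "(\<lambda>i x. 0) \<in> A"
  shows "(\<lambda>i x. c i) \<in> Cinf A"
proof -
  have 0: "(\<lambda>i x. 0) \<in> derivs_in n A" for n
    by (induction n) (auto simp: assms intro!: bexI[where x="\<lambda>i x. 0"])
  have "(\<lambda>i x. c i) \<in> derivs_in n A" for n
    by (cases n) (auto simp: assms intro!: bexI[where x="\<lambda>i x. 0"] 0)
  then show ?thesis by (simp add: Cinf_def)
qed

locale function_algebra =
  fixes A :: "('i \<Rightarrow> real \<Rightarrow> 'a::real_normed_field) set"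
  assumes add_closed: "\<And>g h. g \<in> A \<Longrightarrow> h \<in> A \<Longrightarrow> (\<lambda>i x. g i x + h i x) \<in> A"
    and mult_closed: "\<And>g h. g \<in> A \<Longrightarrow> h \<in> A \<Longrightarrow> (\<lambda>i x. g i x * h i x) \<in> A"
begin

lemma derivs_in_add:
  "g \<in> derivs_in n A \<Longrightarrow> h \<in> derivs_in n A \<Longrightarrow> (\<lambda>i x. g i x + h i x) \<in> derivs_in n A"
proof (induction n arbitrary: g h)
  case (Suc n)
  then obtain g' h' where "g \<in> A" "h \<in> A"
    "g' \<in> derivs_in n A" "\<forall>i x. (g i has_vector_derivative g' i x) (at x)"
    "h' \<in> derivs_in n A" "\<forall>i x. (h i has_vector_derivative h' i x) (at x)" by auto
  then show ?case
    by (auto intro!: add_closed Suc.IH bexI[where x="\<lambda>i x. g' i x + h' i x"]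
        has_vector_derivative_add)
qed (auto intro: add_closed)

lemma derivs_in_mult:
  "g \<in> derivs_in n A \<Longrightarrow> h \<in> derivs_in n A \<Longrightarrow> (\<lambda>i x. g i x * h i x) \<in> derivs_in n A"
proof (induction n arbitrary: g h)
  case (Suc n)
  then obtain g' h' where *: "g \<in> A" "h \<in> A"
    "g' \<in> derivs_in n A" "\<forall>i x. (g i has_vector_derivative g' i x) (at x)"
    "h' \<in> derivs_in n A" "\<forall>i x. (h i has_vector_derivative h' i x) (at x)" by auto
  have "g \<in> derivs_in n A" "h \<in> derivs_in n A" using Suc.prems by (blast dest: derivs_in_Suc_mono)+
  with * show ?case
    by (auto intro!: mult_closed derivs_in_add Suc.IH bexI[where x="\<lambda>i x. g i x * h' i x + g' i x * h i x"]
         has_vector_derivative_mult)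
qed (auto intro: mult_closed)

lemma Cinf_add: "g \<in> Cinf A \<Longrightarrow> h \<in> Cinf A \<Longrightarrow> (\<lambda>i x. g i x + h i x) \<in> Cinf A"
  by (auto simp: Cinf_def intro: derivs_in_add)

lemma Cinf_mult: "g \<in> Cinf A \<Longrightarrow> h \<in> Cinf A \<Longrightarrow> (\<lambda>i x. g i x * h i x) \<in> Cinf A"
  by (auto simp: Cinf_def intro: derivs_in_mult)

end

interpretation all_functions: function_algebra UNIV
  by standard auto

definition unif_bounded :: "'i set \<Rightarrow> ('i \<Rightarrow> real \<Rightarrow> 'a::real_normed_field) set" where
  "unif_bounded I = {g. \<exists>B. \<forall>i\<in>I. \<forall>x. norm (g i x) \<le> B}"

interpretation unif_bounded: function_algebra "unif_bounded I"
proof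
  fix g h :: "'a \<Rightarrow> real \<Rightarrow> 'b"
  assume "g \<in> unif_bounded I" "h \<in> unif_bounded I"
  then obtain B C where B: "\<And>i x. i \<in> I \<Longrightarrow> norm (g i x) \<le> B" and C: "\<And>i x. i \<in> I \<Longrightarrow> norm (h i x) \<le> C"
    unfolding unif_bounded_def by blast
  have "norm (g i x + h i x) \<le> B + C" if "i \<in> I" for i x
    using norm_triangle_ineq[of "g i x" "h i x"] B[OF that, of x] C[OF that, of x] by linarith
  then show "(\<lambda>i x. g i x + h i x) \<in> unif_bounded I" by (auto simp: unif_bounded_def)
  have "norm (g i x * h i x) \<le> B * C" if "i \<in> I" for i x
    using mult_mono'[OF B[OF that] C[OF that], of x x] by (simp add: norm_mult)
  then show "(\<lambda>i x. g i x * h i x) \<in> unif_bounded I" by (auto simp: unif_bounded_def)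
qed

text \<open>
  A single function is treated as a family indexed by the unit type.
\<close>

lemma smooth_if_Cinf:
  assumes "(\<lambda>i::unit. f) \<in> Cinf UNIV"
  shows "smooth f"
proof -
  have "(ddx ^^ n) f differentiable (at x)" if "(\<lambda>i::unit. f) \<in> derivs_in (Suc n) UNIV" for n x f
    using that
  proof (induction n arbitrary: f)
    case 0
    then show ?case by (auto intro: differentiableI_vector)
  next
    case (Suc n)
    then obtain g where g: "g \<in> derivs_in (Suc n) UNIV"
      "\<forall>i x. (f has_vector_derivative g (i::unit) x) (at x)"
      unfolding derivs_in.simps(2)[of "Suc n"] by blast
    then have "g = (\<lambda>i. ddx f)" by (intro ext) (metis vector_derivative_at)
    with g Suc.IH[of "ddx f"] show ?case by (simp add: funpow_Suc_right del: funpow.simps derivs_in.simps)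
  qed
  moreover have "(\<lambda>i::unit. f) \<in> derivs_in (Suc n) UNIV" for n
    using assms unfolding Cinf_def by blast
  ultimately show ?thesis by (auto simp: smooth_def)
qed

lemma smooth_bounded_Cinf:
  assumes "smooth_bounded a"
  shows "(\<lambda>i. a) \<in> Cinf (unif_bounded I)"
proof -
  have "(\<lambda>i. (ddx ^^ k) a) \<in> derivs_in n (unif_bounded I)" for n k
  proof (induction n arbitrary: k)
    case 0
    have "bounded (range ((ddx ^^ k) a))" using assms by (simp add: smooth_bounded_def)
    then show ?case by (auto simp: unif_bounded_def bounded_iff)
  next
    case (Suc n)
    have "bounded (range ((ddx ^^ k) a))" using assms by (simp add: smooth_bounded_def)
    then have 1: "(\<lambda>i. (ddx ^^ k) a) \<in> unif_bounded I" by (auto simp: unif_bounded_def bounded_iff)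
    have 2: "((ddx ^^ k) a has_vector_derivative (ddx ^^ Suc k) a x) (at x)" for x
      using assms by (simp add: smooth_bounded_def smooth_def vector_derivative_works[symmetric])
    show ?case using 1 2 Suc.IH[of "Suc k"]
      by (auto intro!: bexI[where x="\<lambda>i. (ddx ^^ Suc k) a"])
  qed
  from this[of 0] show ?thesis by (simp add: Cinf_def)
qed

lemma Cinf_Re:
  fixes g :: "'i \<Rightarrow> real \<Rightarrow> complex"
  assumes "g \<in> Cinf (unif_bounded I)"
  shows "(\<lambda>i x. Re (g i x)) \<in> Cinf (unif_bounded I)"
proof -
  have ub: "(\<lambda>i x. Re (g i x)) \<in> unif_bounded I" if "g \<in> unif_bounded I" for g :: "'i \<Rightarrow> real \<Rightarrow> complex"
  proof -
    from that obtain B where "\<forall>i\<in>I. \<forall>x. cmod (g i x) \<le> B" by (auto simp: unif_bounded_def)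
    then have "\<forall>i\<in>I. \<forall>x. norm (Re (g i x)) \<le> B"
      by (metis abs_Re_le_cmod order_trans real_norm_def)
    then show ?thesis by (auto simp: unif_bounded_def)
  qed
  have "(\<lambda>i x. Re (g i x)) \<in> derivs_in n (unif_bounded I)"
    if "g \<in> derivs_in n (unif_bounded I)" for n and g :: "'i \<Rightarrow> real \<Rightarrow> complex"
    using that
  proof (induction n arbitrary: g)
    case (Suc n)
    then obtain g' where "g \<in> unif_bounded I" "g' \<in> derivs_in n (unif_bounded I)"
      "\<forall>i x. (g i has_vector_derivative g' i x) (at x)" by auto
    with Suc.IH[of g'] ub show ?case
      by (auto intro!: bexI[where x="\<lambda>i x. Re (g' i x)"]
          simp: bounded_linear.has_vector_derivative[OF bounded_linear_Re])
  qed (auto intro: ub)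
  with assms show ?thesis by (simp add: Cinf_def)
qed

lemma Cinf_of_real:
  fixes g :: "'i \<Rightarrow> real \<Rightarrow> real"
  assumes "g \<in> Cinf UNIV"
  shows "(\<lambda>i x. complex_of_real (g i x)) \<in> Cinf UNIV"
proof -
  have "(\<lambda>i x. complex_of_real (g i x)) \<in> derivs_in n UNIV" if "g \<in> derivs_in n UNIV" for n and g :: "'i \<Rightarrow> real \<Rightarrow> real"
    using that
  proof (induction n arbitrary: g)
    case (Suc n)
    then obtain g' where "g' \<in> derivs_in n UNIV"
      "\<forall>i x. (g i has_vector_derivative g' i x) (at x)" by auto
    with Suc.IH[of g'] show ?case
      by (auto intro!: bexI[where x="\<lambda>i x. complex_of_real (g' i x)"]
          simp: bounded_linear.has_vector_derivative[OF bounded_linear_of_real])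
  qed auto
  with assms show ?thesis by (simp add: Cinf_def)
qed

lemma Cinf_affine:
  fixes g :: "'i \<Rightarrow> real \<Rightarrow> real"
  assumes "g \<in> Cinf UNIV"
  shows "(\<lambda>i x. g i (s * x + t)) \<in> Cinf UNIV"
proof -
  have "(\<lambda>i x. g i (s * x + t)) \<in> derivs_in n UNIV" if "g \<in> derivs_in n UNIV" for n and g :: "'i \<Rightarrow> real \<Rightarrow> real"
    using that
  proof (induction n arbitrary: g)
    case (Suc n)
    then obtain g' where g': "g' \<in> derivs_in n UNIV"
      "\<And>i x. (g i has_vector_derivative g' i x) (at x)" by auto
    have d: "((\<lambda>x. g i (s * x + t)) has_vector_derivative s * g' i (s * x + t)) (at x)" for i x
    proof -
      have "((\<lambda>x. s * x + t) has_real_derivative s) (at x)"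
        by (auto intro!: derivative_eq_intros)
      from DERIV_chain2[OF _ this, of "g i" "g' i (s * x + t)"] g'(2)[of i "s * x + t"]
      show ?thesis by (simp add: has_real_derivative_iff_has_vector_derivative mult.commute)
    qed
    have "(\<lambda>i x. s) \<in> derivs_in n UNIV"
      using Cinf_const[of "\<lambda>i. s" UNIV] by (auto simp: Cinf_def)
    with g' Suc.IH[of g'] d show ?case
      by (auto intro!: bexI[where x="\<lambda>i x. s * g' i (s * x + t)"] all_functions.derivs_in_mult)
  qed auto
  with assms show ?thesis by (simp add: Cinf_def)
qed

section \<open>Smooth bump functions\<close>

text \<open>
  The functions \<open>p (1/x) exp (-1/x)\<close>, extended by zero to the left half line. Allowing an
  arbitrary polynomial \<open>p\<close> makes the class closed under differentiation.
\<close>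

definition flat :: "real poly \<Rightarrow> real \<Rightarrow> real" where
  "flat p x = (if x > 0 then poly p (1 / x) * exp (- (1 / x)) else 0)"

lemma poly_mult_exp_minus_tendsto_0: "((\<lambda>y::real. poly p y * exp (- y)) \<longlongrightarrow> 0) at_top"
proof -
  have "((\<lambda>y. \<Sum>i\<le>degree p. coeff p i * (y ^ i / exp y)) \<longlongrightarrow> (\<Sum>i\<le>degree p. coeff p i * 0)) at_top"
    by (intro tendsto_intros tendsto_power_div_exp_0)
  then show ?thesis
    by (simp add: poly_altdef sum_distrib_right exp_minus divide_inverse mult.assoc)
qed

text \<open>
  For \<open>x > 0\<close> this is the chain rule in \<open>y = 1/x\<close>, which contributes the factor \<open>y\<^sup>2\<close>. At the
  origin the difference quotient is \<open>y p y exp (-y)\<close> with \<open>y \<rightarrow> \<infinity>\<close>, and the exponential wins.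
\<close>

lemma flat_deriv: "(flat p has_real_derivative flat (monom 1 2 * (p - pderiv p)) x) (at x)"
proof -
  consider "x > 0" | "x < 0" | "x = 0" by linarith
  then show ?thesis
  proof cases
    case 1
    have "((\<lambda>x. poly p (1 / x) * exp (- (1 / x))) has_real_derivative
        flat (monom 1 2 * (p - pderiv p)) x) (at x)"
      using 1 by (auto intro!: derivative_eq_intros DERIV_chain2[OF poly_DERIV]
          simp: flat_def poly_monom field_simps power2_eq_square)
    then show ?thesis
      by (rule has_field_derivative_transform_within_open[where S="{0<..}"])
        (use 1 in \<open>auto simp: flat_def\<close>)
  next
    case 2
    have "((\<lambda>x. 0) has_real_derivative flat (monom 1 2 * (p - pderiv p)) x) (at x)"
      using 2 by (auto simp: flat_def)
    then show ?thesis
      by (rule has_field_derivative_transform_within_open[where S="{..<0}"])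
        (use 2 in \<open>auto simp: flat_def\<close>)
  next
    case 3
    have "((\<lambda>x. (flat p x - flat p 0) / (x - 0)) \<longlongrightarrow> 0) (at 0)"
    proof -
      have l: "((\<lambda>x. (flat p x - flat p 0) / (x - 0)) \<longlongrightarrow> 0) (at_left 0)"
        by (rule tendsto_eventually) (auto simp: flat_def eventually_at_left_field intro!: exI[of _ "-1"])
      have "((\<lambda>x. poly (monom 1 1 * p) (inverse x) * exp (- inverse x)) \<longlongrightarrow> 0) (at_right 0)"
        by (rule filterlim_compose[OF poly_mult_exp_minus_tendsto_0 filterlim_inverse_at_top_right])
      then have r: "((\<lambda>x. (flat p x - flat p 0) / (x - 0)) \<longlongrightarrow> 0) (at_right 0)"
        by (rule Lim_transform_eventually)
          (auto simp: flat_def eventually_at_right_field poly_monom field_simps intro!: exI[of _ 1])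
      from l r show "((\<lambda>x. (flat p x - flat p 0) / (x - 0)) \<longlongrightarrow> 0) (at 0)"
        by (simp add: filterlim_split_at_real)
    qed
    then show ?thesis using 3 by (simp add: has_field_derivative_iff flat_def)
  qed
qed

lemma flat_Cinf: "(\<lambda>i::'i. flat p) \<in> Cinf UNIV"
proof -
  have "(\<lambda>i::'i. flat p) \<in> derivs_in n UNIV" for n
  proof (induction n arbitrary: p)
    case (Suc n)
    show ?case
      using Suc.IH[of "monom 1 2 * (p - pderiv p)"] flat_deriv[of p]
      by (auto simp: has_real_derivative_iff_has_vector_derivative
          intro!: bexI[where x="\<lambda>i::'i. flat (monom 1 2 * (p - pderiv p))"])
  qed simp
  then show ?thesis by (simp add: Cinf_def)
qed

definition bump :: "real \<Rightarrow> real \<Rightarrow> real \<Rightarrow> real" where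
  "bump p q x = flat 1 (x - p) * flat 1 (q - x)"

lemma bump_pos: "p < x \<Longrightarrow> x < q \<Longrightarrow> bump p q x > 0"
  and bump_zero: "x \<notin> {p<..<q} \<Longrightarrow> bump p q x = 0"
  by (auto simp: bump_def flat_def)

lemma bump_Cinf: "(\<lambda>i. bump p q) \<in> Cinf UNIV"
proof -
  have "(\<lambda>i. flat 1) \<in> Cinf UNIV" by (rule flat_Cinf)
  from all_functions.Cinf_mult[OF Cinf_affine[OF this, of 1 "-p"] Cinf_affine[OF this, of "-1" q]]
  show ?thesis by (simp add: bump_def[abs_def] add.commute)
qed

section \<open>Symmetry of the operator in terms of its coefficients\<close>

lemma LINT_eq_integral_of_support:
  fixes f :: "real \<Rightarrow> 'a::euclidean_space"
  assumes "continuous_on UNIV f" "\<And>x. x \<notin> {p..q} \<Longrightarrow> f x = 0"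
  shows "integrable lborel f" "(LINT x|lborel. f x) = integral {p..q} f"
proof -
  have eq: "(\<lambda>x. indicator {p..q} x *\<^sub>R f x) = f"
    using assms(2) by (auto simp: fun_eq_iff indicator_def)
  have si: "set_integrable lborel {p..q} f"
    by (rule borel_integrable_atLeastAtMost') (rule continuous_on_subset[OF assms(1)], simp)
  then show "integrable lborel f" by (simp add: set_integrable_def eq)
  show "(LINT x|lborel. f x) = integral {p..q} f"
    using set_borel_integral_eq_integral(2)[OF si] by (simp add: set_lebesgue_integral_def eq)
qed

text \<open>
  The derivative vanishes also at the two endpoints, because \<open>bump p q\<close> is nonnegative and so
  has a minimum at each of its zeros.
\<close>

lemma bump_deriv:
  obtains b' where "\<And>x. (bump p q has_real_derivative b' x) (at x)" "continuous_on UNIV b'"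
    "\<And>x. x \<notin> {p<..<q} \<Longrightarrow> b' x = 0"
proof -
  have "(\<lambda>i::unit. bump p q) \<in> Cinf UNIV" by (rule bump_Cinf)
  then obtain g where g: "g \<in> Cinf UNIV" "\<And>i x. (bump p q has_vector_derivative g (i::unit) x) (at x)"
    using Cinf_deriv by metis
  obtain g' where "\<And>i x. (g i has_vector_derivative g' (i::unit) x) (at x)"
    using Cinf_deriv[OF g(1)] by metis
  then have c: "continuous_on UNIV (g ())"
    by (meson continuous_at_imp_continuous_on has_vector_derivative_continuous)
  have d: "(bump p q has_real_derivative g () x) (at x)" for x
    using g(2) by (simp add: has_real_derivative_iff_has_vector_derivative)
  have "g () x = 0" if "x \<notin> {p<..<q}" for x
  proof (rule DERIV_local_min[OF d zero_less_one], intro allI impI)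
    show "bump p q x \<le> bump p q y" for y
      using bump_pos[of p y q] bump_zero[OF that] bump_zero[of y p q] by force
  qed
  with c d that show ?thesis by blast
qed

lemma bump_continuous: "continuous_on UNIV (bump p q)"
  by (meson bump_deriv DERIV_isCont continuous_at_imp_continuous_on)

text \<open>
  The fundamental lemma of the calculus of variations: if \<open>g x \<noteq> 0\<close>, then \<open>g x * g y\<close> is positive
  for \<open>y\<close> near \<open>x\<close>, and a bump supported there would have a positive integral against it.
\<close>

lemma eq_zero_if_integral_bump_eq_zero:
  fixes g :: "real \<Rightarrow> real"
  assumes g: "continuous_on UNIV g"
    and int: "\<And>p q. p < q \<Longrightarrow> integral {p..q} (\<lambda>x. g x * (bump p q x)\<^sup>2) = 0"
  shows "g x = 0"
proof (rule ccontr)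
  assume "g x \<noteq> 0"
  have "isCont (\<lambda>y. g x * g y) x"
    using g by (intro continuous_intros) (simp add: continuous_on_eq_continuous_at)
  moreover have "g x * g x > 0" using \<open>g x \<noteq> 0\<close> by (simp add: zero_less_mult_iff linorder_neq_iff) linarith
  ultimately have "\<forall>\<^sub>F y in nhds x. g x * g y > 0"
    by (metis continuous_at tendsto_at_iff_tendsto_nhds order_tendstoD(1))
  then obtain d where d: "d > 0" "\<And>y. \<bar>y - x\<bar> < d \<Longrightarrow> g x * g y > 0"
    by (auto simp: eventually_nhds_metric dist_real_def)
  define p q where "p = x - d / 2" and "q = x + d / 2"
  have pq: "p < q" "x \<in> {p<..<q}" using d by (auto simp: p_def q_def)
  let ?f = "\<lambda>y. g x * (g y * (bump p q y)\<^sup>2)"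
  have c: "continuous_on {p..q} (bump p q)"
    using bump_continuous continuous_on_subset by blast
  have "continuous_on {p..q} ?f"
    by (intro continuous_intros c continuous_on_subset[OF g]) auto
  moreover have "?f y \<ge> 0" if "y \<in> {p..q}" for y
  proof -
    have "g x * g y > 0" using d that by (intro d(2)) (auto simp: p_def q_def abs_if)
    then have "g x * g y * (bump p q y)\<^sup>2 \<ge> 0" by simp
    then show ?thesis by (simp add: mult.assoc)
  qed
  moreover have "integral {p..q} ?f = 0" using int[OF pq(1)] by simp
  ultimately have "?f x = 0" using integral_eq_0_iff[of p q ?f] pq by auto
  with \<open>g x \<noteq> 0\<close> bump_pos[of p x q] pq show False by auto
qed

text \<open>
  For real \<open>f, g\<close> the symmetry of the operator says that
  \<open>T(f,g) = \<integral> - \<i> a\<^sub>1 f' g - \<i> cnj a\<^sub>1 f g' + 2 \<i> (Im a\<^sub>0) f g\<close> is zero. The antisymmetric part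
  \<open>T(f,g) - T(g,f)\<close> only involves \<open>Im a\<^sub>1 * (f' g - f g')\<close>, and the Wronskian factor becomes the
  square of a bump \<open>b\<close> for \<open>f = x b\<close>, \<open>g = b\<close>; this kills \<open>Im a\<^sub>1\<close>. The choice \<open>f = g = b\<close> then gives
  \<open>\<integral> (Im a\<^sub>0) b\<^sup>2 - (Re a\<^sub>1) b b' = 0\<close>, and an integration by parts turns this into
  \<open>\<integral> (Re a\<^sub>1' + 2 Im a\<^sub>0) b\<^sup>2 = 0\<close>.
\<close>

lemma self_adjoint_coefficients:
  assumes sa: "formally_self_adjoint (\<lambda>u x. a\<^sub>1 x * D_op u x + a\<^sub>0 x * u x)"
    and a1: "\<And>x. (a\<^sub>1 has_vector_derivative a\<^sub>1' x) (at x)" "continuous_on UNIV a\<^sub>1'"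
    and a0: "continuous_on UNIV a\<^sub>0"
  shows "Im (a\<^sub>1 x) = 0" and "Re (a\<^sub>1' x) = - 2 * Im (a\<^sub>0 x)"
proof -
  have ca1: "continuous_on UNIV a\<^sub>1"
    using has_vector_derivative_continuous[OF a1(1)] by (intro continuous_at_imp_continuous_on ballI)
  have pairing: "((\<lambda>x. - \<i> * a\<^sub>1 x * of_real (f' x * g x) - \<i> * cnj (a\<^sub>1 x) * of_real (f x * g' x)
      + (a\<^sub>0 x - cnj (a\<^sub>0 x)) * of_real (f x * g x)) has_integral 0) {p..q}"
    if f: "(\<lambda>i::unit. f) \<in> Cinf UNIV" and g: "(\<lambda>i::unit. g) \<in> Cinf UNIV"
      and f': "\<And>x. (f has_real_derivative f' x) (at x)" "continuous_on UNIV f'"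
      and g': "\<And>x. (g has_real_derivative g' x) (at x)" "continuous_on UNIV g'"
      and zero: "\<And>x. x \<notin> {p<..<q} \<Longrightarrow> f x = 0 \<and> f' x = 0 \<and> g x = 0 \<and> g' x = 0"
    for f g f' g' :: "real \<Rightarrow> real" and p q
  proof -
    have test: "test_function (\<lambda>x. complex_of_real (h x))"
      if "(\<lambda>i::unit. h) \<in> Cinf UNIV" "\<And>x. x \<notin> {p<..<q} \<Longrightarrow> h x = 0" for h
    proof -
      have "{x. complex_of_real (h x) \<noteq> 0} \<subseteq> {p..q}"
        by (rule subsetI, rule ccontr) (use that(2) in auto)
      then have "bounded {x. complex_of_real (h x) \<noteq> 0}" using bounded_subset bounded_closed_interval by blast
      then show ?thesis
        using smooth_if_Cinf[OF Cinf_of_real[OF that(1)]] by (simp add: test_function_def)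
    qed
    have dd: "ddx (\<lambda>x. complex_of_real (h x)) x = of_real (h' x)"
      if "\<And>x. (h has_real_derivative h' x) (at x)" for h h' x
      using that[of x] by (intro vector_derivative_at)
        (simp add: has_real_derivative_iff_has_vector_derivative bounded_linear.has_vector_derivative[OF bounded_linear_of_real])
    have cf: "continuous_on UNIV f" "continuous_on UNIV g"
      using f'(1) g'(1) by (meson DERIV_isCont continuous_at_imp_continuous_on)+
    let ?L = "\<lambda>x. (a\<^sub>1 x * (- \<i> * of_real (f' x)) + a\<^sub>0 x * of_real (f x)) * of_real (g x)"
    let ?R = "\<lambda>x. of_real (f x) * cnj (a\<^sub>1 x * (- \<i> * of_real (g' x)) + a\<^sub>0 x * of_real (g x))"
    note conts = ca1 a0 f'(2) g'(2) cf
    have cL: "continuous_on UNIV ?L" and cR: "continuous_on UNIV ?R"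
      by (intro continuous_intros conts)+
    have z: "?L x = 0" "?R x = 0" "?L x - ?R x = 0" if "x \<notin> {p..q}" for x
      using zero[of x] that by auto
    have L: "integrable lborel ?L" "(LINT x|lborel. ?L x) = integral {p..q} ?L"
      by (rule LINT_eq_integral_of_support[OF cL z(1)]; assumption)+
    have R: "integrable lborel ?R" "(LINT x|lborel. ?R x) = integral {p..q} ?R"
      by (rule LINT_eq_integral_of_support[OF cR z(2)]; assumption)+
    have "(LINT x|lborel. ?L x) = (LINT x|lborel. ?R x)"
      using sa[unfolded formally_self_adjoint_def, rule_format, OF conjI[OF test[OF f] test[OF g]]] zero
      by (simp add: L2_inner_def D_op_def dd[OF f'(1)] dd[OF g'(1)])
    then have "(LINT x|lborel. ?L x - ?R x) = 0" using L R by simp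
    moreover have "(\<lambda>x. ?L x - ?R x) = (\<lambda>x. - \<i> * a\<^sub>1 x * of_real (f' x * g x) - \<i> * cnj (a\<^sub>1 x) * of_real (f x * g' x)
      + (a\<^sub>0 x - cnj (a\<^sub>0 x)) * of_real (f x * g x))"
      by (simp add: fun_eq_iff algebra_simps)
    moreover have "(LINT x|lborel. ?L x - ?R x) = integral {p..q} (\<lambda>x. ?L x - ?R x)"
      by (rule LINT_eq_integral_of_support(2)[OF continuous_on_diff[OF cL cR] z(3)])
    moreover have "(\<lambda>x. ?L x - ?R x) integrable_on {p..q}"
      by (rule integrable_continuous_real) (rule continuous_on_subset[OF continuous_on_diff[OF cL cR]], simp)
    ultimately show ?thesis by (metis (no_types, lifting) has_integral_integrable_integral)
  qed
  have "integral {p..q} (\<lambda>x. Im (a\<^sub>1 x) * (bump p q x)\<^sup>2) = 0" for p q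
  proof -
    let ?b = "bump p q"
    obtain b' where b': "\<And>x. (?b has_real_derivative b' x) (at x)" "continuous_on UNIV b'"
      "\<And>x. x \<notin> {p<..<q} \<Longrightarrow> b' x = 0"
      using bump_deriv[of p q] by blast
    have id: "(\<lambda>i::unit. \<lambda>x. x) \<in> Cinf UNIV"
    proof -
      have one: "(\<lambda>i::unit. \<lambda>x. 1 :: real) \<in> derivs_in n UNIV" for n
        using Cinf_const[of "\<lambda>i::unit. 1 :: real" UNIV] by (auto simp: Cinf_def)
      have "(\<lambda>i::unit. \<lambda>x. x :: real) \<in> derivs_in n UNIV" for n
        by (cases n) (auto intro!: bexI[OF _ one] derivative_intros)
      then show ?thesis by (simp add: Cinf_def)
    qed
    have 1: "((\<lambda>x. x * ?b x) has_real_derivative (?b x + x * b' x)) (at x)" for x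
      using b' by (auto intro!: derivative_eq_intros)
    have 2: "continuous_on UNIV (\<lambda>x. ?b x + x * b' x)"
      by (intro continuous_intros bump_continuous b')
    have 3: "x * ?b x = 0 \<and> ?b x + x * b' x = 0 \<and> ?b x = 0 \<and> b' x = 0" if "x \<notin> {p<..<q}" for x
      using b'(3) bump_zero that by auto
    from 3 have 4: "?b x = 0 \<and> b' x = 0 \<and> x * ?b x = 0 \<and> ?b x + x * b' x = 0" if "x \<notin> {p<..<q}" for x
      using that by blast
    have "((\<lambda>x. complex_of_real (2 * (Im (a\<^sub>1 x) * (?b x)\<^sup>2))) has_integral 0 - 0) {p..q}"
      by (rule has_integral_eq[OF _ has_integral_diff[OF
            pairing[OF all_functions.Cinf_mult[OF id bump_Cinf] bump_Cinf 1 2 b'(1,2) 3]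
            pairing[OF bump_Cinf all_functions.Cinf_mult[OF id bump_Cinf] b'(1,2) 1 2 4]]])
        (auto simp: complex_eq_iff algebra_simps power2_eq_square)
    from has_integral_linear[OF this bounded_linear_Re]
    have "((\<lambda>x. 2 * (Im (a\<^sub>1 x) * (?b x)\<^sup>2)) has_integral 0) {p..q}" by (simp add: o_def)
    then show ?thesis by (auto dest: integral_unique)
  qed
  then show "Im (a\<^sub>1 x) = 0" for x
    by (intro eq_zero_if_integral_bump_eq_zero[where g="\<lambda>x. Im (a\<^sub>1 x)"] continuous_intros ca1)
  have "integral {p..q} (\<lambda>x. (Re (a\<^sub>1' x) + 2 * Im (a\<^sub>0 x)) * (bump p q x)\<^sup>2) = 0" if "p < q" for p q
  proof -
    let ?b = "bump p q"
    obtain b' where b': "\<And>x. (?b has_real_derivative b' x) (at x)" "continuous_on UNIV b'"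
      "\<And>x. x \<notin> {p<..<q} \<Longrightarrow> b' x = 0"
      using bump_deriv[of p q] by blast
    have 3: "?b x = 0 \<and> b' x = 0 \<and> ?b x = 0 \<and> b' x = 0" if "x \<notin> {p<..<q}" for x
      using b'(3) bump_zero that by auto
    from has_integral_linear[OF pairing[OF bump_Cinf bump_Cinf b'(1,2) b'(1,2) 3] bounded_linear_Im]
    have A: "((\<lambda>x. 2 * Im (a\<^sub>0 x) * (?b x)\<^sup>2 - 2 * Re (a\<^sub>1 x) * ?b x * b' x) has_integral 0) {p..q}"
      by (simp add: o_def algebra_simps power2_eq_square)
    have "((\<lambda>x. Re (a\<^sub>1 x) * (?b x)\<^sup>2) has_vector_derivative
        (Re (a\<^sub>1' x) * (?b x)\<^sup>2 + 2 * Re (a\<^sub>1 x) * ?b x * b' x)) (at x within {p..q})" for x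
    proof -
      have "((\<lambda>x. Re (a\<^sub>1 x)) has_real_derivative Re (a\<^sub>1' x)) (at x)"
        using bounded_linear.has_vector_derivative[OF bounded_linear_Re a1(1)]
        by (simp add: has_real_derivative_iff_has_vector_derivative)
      then have "((\<lambda>x. Re (a\<^sub>1 x) * (?b x)\<^sup>2) has_real_derivative
        (Re (a\<^sub>1' x) * (?b x)\<^sup>2 + 2 * Re (a\<^sub>1 x) * ?b x * b' x)) (at x)"
        by (rule DERIV_cong[OF DERIV_mult[OF _ DERIV_power[OF b'(1)]]]) (simp add: algebra_simps)
      then show ?thesis
        by (simp add: has_real_derivative_iff_has_vector_derivative has_vector_derivative_at_within)
    qed
    from fundamental_theorem_of_calculus[OF less_imp_le[OF that] this]
    have B: "((\<lambda>x. Re (a\<^sub>1' x) * (?b x)\<^sup>2 + 2 * Re (a\<^sub>1 x) * ?b x * b' x) has_integral 0) {p..q}"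
      by (simp add: bump_zero)
    have "((\<lambda>x. (Re (a\<^sub>1' x) + 2 * Im (a\<^sub>0 x)) * (?b x)\<^sup>2) has_integral 0 + 0) {p..q}"
      by (rule has_integral_eq[OF _ has_integral_add[OF A B]]) (simp add: algebra_simps)
    then show ?thesis by (auto dest: integral_unique)
  qed
  then have "Re (a\<^sub>1' x) + 2 * Im (a\<^sub>0 x) = 0"
    by (intro eq_zero_if_integral_bump_eq_zero[where g="\<lambda>x. Re (a\<^sub>1' x) + 2 * Im (a\<^sub>0 x)"] continuous_intros a1 a0)
  then show "Re (a\<^sub>1' x) = - 2 * Im (a\<^sub>0 x)" by simp
qed

section \<open>An almost conserved quadratic form\<close>

lemma Cinf_unif_const:
  assumes "\<And>i. i \<in> I \<Longrightarrow> norm (c i) \<le> B"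
  shows "(\<lambda>i x. c i) \<in> Cinf (unif_bounded I)"
  by (rule Cinf_const) (use assms in \<open>auto simp: unif_bounded_def\<close>)

lemma Cinf_unif_cmult: "g \<in> Cinf (unif_bounded I) \<Longrightarrow> (\<lambda>i x. c * g i x) \<in> Cinf (unif_bounded I)"
  by (rule unif_bounded.Cinf_mult[OF Cinf_unif_const[of I "\<lambda>i. c" "norm c"]]) auto

lemma Cinf_unif_diff:
  "g \<in> Cinf (unif_bounded I) \<Longrightarrow> h \<in> Cinf (unif_bounded I) \<Longrightarrow>
     (\<lambda>i x. g i x - h i x) \<in> Cinf (unif_bounded I)"
  using unif_bounded.Cinf_add[of g I "\<lambda>i x. (-1) * h i x", OF _ Cinf_unif_cmult] by simp

lemma Cinf_real_deriv:
  fixes g :: "'i \<Rightarrow> real \<Rightarrow> real"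
  assumes "g \<in> Cinf A"
  obtains g' where "g' \<in> Cinf A" "\<And>i x. (g i has_real_derivative g' i x) (at x)"
  using Cinf_deriv[OF assms] by (metis has_real_derivative_iff_has_vector_derivative)

lemma Cinf_unif_bound:
  assumes "g \<in> Cinf (unif_bounded I)"
  obtains B where "B \<ge> 0" "\<And>i x. i \<in> I \<Longrightarrow> norm (g i x) \<le> B"
proof -
  obtain B where B: "\<And>i x. i \<in> I \<Longrightarrow> norm (g i x) \<le> B"
    using Cinf_mem[OF assms] unfolding unif_bounded_def by blast
  show ?thesis by (rule that[of "max B 0"]) (auto intro: B order_trans[OF B])
qed

text \<open>
  The parameter \<open>\<epsilon>\<close> stands for \<open>1/\<rho>\<^sup>2\<close>; all bounds are uniform for \<open>0 < \<epsilon> < 1\<close>, that is, for \<open>\<rho> > 1\<close>.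
\<close>

abbreviation unif_smooth :: "(real \<Rightarrow> real \<Rightarrow> real) set" where
  "unif_smooth \<equiv> Cinf (unif_bounded {0<..<1})"

lemmas unif_smooth_intros =
  unif_bounded.Cinf_add unif_bounded.Cinf_mult Cinf_unif_diff Cinf_unif_cmult

text \<open>
  If \<open>v'' = (W - \<rho>\<^sup>2) v\<close>, then products \<open>\<gamma>\<close> of two solutions satisfy the third order equation
  \<open>\<gamma>'''/2 + 2 \<gamma>' (\<rho>\<^sup>2 - W) - \<gamma> W' = 0\<close>. Solving this equation in powers of \<open>\<epsilon>\<close> would require
  integrating in \<open>x\<close>, which does not preserve boundedness. Multiplied by \<open>\<gamma>\<close> it has the first integral
  \<open>\<gamma> \<gamma>''/2 - \<gamma>'\<^sup>2/4 + (\<rho>\<^sup>2 - W) \<gamma>\<^sup>2 = const\<close>; with the constant \<open>\<rho>\<^sup>2\<close> and after scaling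
  by \<open>\<epsilon>\<close> this is an equation whose leading part \<open>\<gamma>\<^sup>2 = 1\<close> is algebraic, so it can be solved to any order
  without integration. An error \<open>\<epsilon>\<^sup>M\<^sup>+\<^sup>1 h\<close> is removed by subtracting \<open>\<epsilon>\<^sup>M\<^sup>+\<^sup>1 h/2\<close> from
  \<open>\<gamma> = 1 + \<epsilon> k\<close>: the change of \<open>\<gamma>\<^sup>2\<close> cancels it because \<open>\<gamma> = 1 + O(\<epsilon>)\<close>, and everything else
  carries one more factor \<open>\<epsilon>\<close>.
\<close>

lemma approximate_amplitude:
  fixes W :: "real \<Rightarrow> real" and M :: nat
  assumes W: "(\<lambda>\<epsilon>. W) \<in> unif_smooth"
  shows "\<exists>k k1 k2 h. k \<in> unif_smooth \<and> k1 \<in> unif_smooth \<and> k2 \<in> unif_smooth \<and> h \<in> unif_smooth \<and>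
    (\<forall>\<epsilon> x. (k \<epsilon> has_real_derivative k1 \<epsilon> x) (at x)) \<and>
    (\<forall>\<epsilon> x. (k1 \<epsilon> has_real_derivative k2 \<epsilon> x) (at x)) \<and>
    (\<forall>\<epsilon> x. \<epsilon> * ((1 + \<epsilon> * k \<epsilon> x) * (\<epsilon> * k2 \<epsilon> x) / 2 - (\<epsilon> * k1 \<epsilon> x)\<^sup>2 / 4 - (1 + \<epsilon> * k \<epsilon> x)\<^sup>2 * W x)
       + (1 + \<epsilon> * k \<epsilon> x)\<^sup>2 = 1 + \<epsilon> ^ Suc M * h \<epsilon> x)"
proof (induction M)
  case 0
  have z: "(\<lambda>\<epsilon> x. 0) \<in> unif_smooth" by (rule Cinf_unif_const[where B=0]) auto
  have "(\<lambda>\<epsilon> x. - W x) \<in> unif_smooth" using Cinf_unif_cmult[OF W, of "-1"] by simp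
  with z show ?case
    by (intro exI[where x="\<lambda>\<epsilon> x. 0"] exI[where x="\<lambda>\<epsilon> x. - W x"]) auto
next
  case (Suc M)
  then obtain k k1 k2 h where U: "k \<in> unif_smooth" "k1 \<in> unif_smooth" "k2 \<in> unif_smooth" "h \<in> unif_smooth"
    and d: "\<And>\<epsilon> x. (k \<epsilon> has_real_derivative k1 \<epsilon> x) (at x)"
      "\<And>\<epsilon> x. (k1 \<epsilon> has_real_derivative k2 \<epsilon> x) (at x)"
    and eq: "\<And>\<epsilon> x. \<epsilon> * ((1 + \<epsilon> * k \<epsilon> x) * (\<epsilon> * k2 \<epsilon> x) / 2 - (\<epsilon> * k1 \<epsilon> x)\<^sup>2 / 4 - (1 + \<epsilon> * k \<epsilon> x)\<^sup>2 * W x)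
       + (1 + \<epsilon> * k \<epsilon> x)\<^sup>2 = 1 + \<epsilon> ^ Suc M * h \<epsilon> x"
    by blast
  define s where "s = (\<lambda>\<epsilon> x. (- 1 / 2) * h \<epsilon> x)"
  have s: "s \<in> unif_smooth" unfolding s_def by (rule Cinf_unif_cmult[OF U(4)])
  obtain s1 where s1: "s1 \<in> unif_smooth" "\<And>\<epsilon> x. (s \<epsilon> has_real_derivative s1 \<epsilon> x) (at x)"
    using Cinf_real_deriv[OF s] by metis
  obtain s2 where s2: "s2 \<in> unif_smooth" "\<And>\<epsilon> x. (s1 \<epsilon> has_real_derivative s2 \<epsilon> x) (at x)"
    using Cinf_real_deriv[OF s1(1)] by metis
  have p: "(\<lambda>\<epsilon> x. \<epsilon> ^ M) \<in> unif_smooth"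
    by (rule Cinf_unif_const[where B=1]) (auto simp: power_le_one)
  have i: "(\<lambda>\<epsilon> x. \<epsilon>) \<in> unif_smooth" and one: "(\<lambda>\<epsilon> x. 1) \<in> unif_smooth"
    by (rule Cinf_unif_const[where B=1]; auto)+
  note mem = p i one U W s s1(1) s2(1)
  \<comment> \<open>The new error, read off from the ring identity below after the factor \<open>\<epsilon>\<close> to the
    power \<open>M + 2\<close> has been taken out.\<close>
  define h' where "h' = (\<lambda>\<epsilon> x. (1/2) * ((1 + \<epsilon> * k \<epsilon> x) * s2 \<epsilon> x + s \<epsilon> x * (\<epsilon> * k2 \<epsilon> x)
        + \<epsilon> * (\<epsilon> ^ M * (s \<epsilon> x * s2 \<epsilon> x)))
      - (1/4) * (2 * (\<epsilon> * (k1 \<epsilon> x * s1 \<epsilon> x)) + \<epsilon> * (\<epsilon> ^ M * (s1 \<epsilon> x * s1 \<epsilon> x)))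
      - (2 * ((1 + \<epsilon> * k \<epsilon> x) * s \<epsilon> x) + \<epsilon> * (\<epsilon> ^ M * (s \<epsilon> x * s \<epsilon> x))) * W x
      + 2 * (k \<epsilon> x * s \<epsilon> x) + \<epsilon> ^ M * (s \<epsilon> x * s \<epsilon> x))"
  have "h' \<in> unif_smooth"
    unfolding h'_def by (intro unif_smooth_intros mem)
  moreover have "(\<lambda>\<epsilon> x. k \<epsilon> x + \<epsilon> ^ M * s \<epsilon> x) \<in> unif_smooth"
    "(\<lambda>\<epsilon> x. k1 \<epsilon> x + \<epsilon> ^ M * s1 \<epsilon> x) \<in> unif_smooth"
    "(\<lambda>\<epsilon> x. k2 \<epsilon> x + \<epsilon> ^ M * s2 \<epsilon> x) \<in> unif_smooth"
    by (intro unif_smooth_intros mem)+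
  moreover have "((\<lambda>x. k \<epsilon> x + \<epsilon> ^ M * s \<epsilon> x) has_real_derivative k1 \<epsilon> x + \<epsilon> ^ M * s1 \<epsilon> x) (at x)"
    "((\<lambda>x. k1 \<epsilon> x + \<epsilon> ^ M * s1 \<epsilon> x) has_real_derivative k2 \<epsilon> x + \<epsilon> ^ M * s2 \<epsilon> x) (at x)" for \<epsilon> x
    by (intro DERIV_add DERIV_cmult d s1 s2)+
  moreover have "\<epsilon> * ((1 + \<epsilon> * (k \<epsilon> x + \<epsilon> ^ M * s \<epsilon> x)) * (\<epsilon> * (k2 \<epsilon> x + \<epsilon> ^ M * s2 \<epsilon> x)) / 2
        - (\<epsilon> * (k1 \<epsilon> x + \<epsilon> ^ M * s1 \<epsilon> x))\<^sup>2 / 4 - (1 + \<epsilon> * (k \<epsilon> x + \<epsilon> ^ M * s \<epsilon> x))\<^sup>2 * W x)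
       + (1 + \<epsilon> * (k \<epsilon> x + \<epsilon> ^ M * s \<epsilon> x))\<^sup>2 = 1 + \<epsilon> ^ Suc (Suc M) * h' \<epsilon> x" for \<epsilon> x
  proof -
    have ring: "e * ((1 + e * (k + p * s)) * (e * (k2 + p * s2)) / 2
        - (e * (k1 + p * s1))\<^sup>2 / 4 - (1 + e * (k + p * s))\<^sup>2 * w) + (1 + e * (k + p * s))\<^sup>2
      = e * ((1 + e * k) * (e * k2) / 2 - (e * k1)\<^sup>2 / 4 - (1 + e * k)\<^sup>2 * w) + (1 + e * k)\<^sup>2
        + 2 * (e * p * s) + e * (e * p) * ((1/2) * ((1 + e * k) * s2 + s * (e * k2) + e * (p * (s * s2)))
          - (1/4) * (2 * (e * (k1 * s1)) + e * (p * (s1 * s1)))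
          - (2 * ((1 + e * k) * s) + e * (p * (s * s))) * w + 2 * (k * s) + p * (s * s))"
      for e k k1 k2 p s s1 s2 w :: real
      by (simp add: field_simps power2_eq_square)
    have "h \<epsilon> x = - 2 * s \<epsilon> x" by (simp add: s_def)
    then show ?thesis
      unfolding ring h'_def eq by simp
  qed
  ultimately show ?case by blast
qed

text \<open>
  For a solution of \<open>v'' = (W - \<rho>\<^sup>2) v\<close> the form \<open>g |v'|\<^sup>2 - g' Re (cnj v v') + d |v|\<^sup>2\<close> with
  \<open>d = g''/2 - g (W - \<rho>\<^sup>2)\<close> has the derivative \<open>(d' - g' (W - \<rho>\<^sup>2)) |v|\<^sup>2\<close>: the choice of \<open>d\<close>
  cancels the mixed terms. With the approximate amplitude for \<open>g\<close> this
  coefficient is small, since \<open>g\<close> times it is the derivative of the first integral.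
\<close>

lemma almost_invariant_form:
  fixes W :: "real \<Rightarrow> real" and M :: nat
  assumes W: "(\<lambda>\<epsilon>. W) \<in> unif_smooth"
  shows "\<exists>K>0. \<forall>\<rho>>1. \<exists>g g' d d'.
    (\<forall>x. (g has_real_derivative g' x) (at x)) \<and>
    (\<forall>x. (g' has_real_derivative 2 * (d x + g x * (W x - \<rho>\<^sup>2))) (at x)) \<and>
    (\<forall>x. (d has_real_derivative d' x) (at x)) \<and>
    (\<forall>x. \<bar>g x - 1\<bar> \<le> K / \<rho>\<^sup>2 \<and> \<bar>g' x\<bar> \<le> K / \<rho>\<^sup>2 \<and> \<bar>d x - \<rho>\<^sup>2\<bar> \<le> K \<and>
      \<bar>g x * (d' x - g' x * (W x - \<rho>\<^sup>2))\<bar> \<le> K / \<rho> ^ (2 * M))"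
proof -
  obtain k k1 k2 h where U: "k \<in> unif_smooth" "k1 \<in> unif_smooth" "k2 \<in> unif_smooth" "h \<in> unif_smooth"
    and d: "\<And>\<epsilon> x. (k \<epsilon> has_real_derivative k1 \<epsilon> x) (at x)"
      "\<And>\<epsilon> x. (k1 \<epsilon> has_real_derivative k2 \<epsilon> x) (at x)"
    and eq: "\<And>\<epsilon> x. \<epsilon> * ((1 + \<epsilon> * k \<epsilon> x) * (\<epsilon> * k2 \<epsilon> x) / 2 - (\<epsilon> * k1 \<epsilon> x)\<^sup>2 / 4 - (1 + \<epsilon> * k \<epsilon> x)\<^sup>2 * W x)
       + (1 + \<epsilon> * k \<epsilon> x)\<^sup>2 = 1 + \<epsilon> ^ Suc M * h \<epsilon> x"
    using approximate_amplitude[OF W, of M] by blast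
  obtain k3 where k3: "\<And>\<epsilon> x. (k2 \<epsilon> has_real_derivative k3 \<epsilon> x) (at x)"
    using Cinf_real_deriv[OF U(3)] by metis
  obtain h1 where h1: "h1 \<in> unif_smooth" "\<And>\<epsilon> x. (h \<epsilon> has_real_derivative h1 \<epsilon> x) (at x)"
    using Cinf_real_deriv[OF U(4)] by metis
  obtain W' where "\<And>\<epsilon> x. (W has_real_derivative W' (\<epsilon>::real) x) (at x)"
    using Cinf_real_deriv[OF W] by metis
  then have W1: "(W has_real_derivative W' 0 x) (at x)" for x by blast
  have I: "1 / \<rho>\<^sup>2 \<in> {0<..<1}" if "\<rho> > 1" for \<rho> :: real
    using that by (simp add: power_strict_mono[of 1 \<rho> 2, simplified])
  \<comment> \<open>This is \<open>d - \<rho>\<^sup>2\<close> with \<open>1/\<rho>\<^sup>2\<close> written as \<open>\<epsilon>\<close>: the large terms \<open>\<rho>\<^sup>2 g\<close> and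
    \<open>\<rho>\<^sup>2\<close> leave only \<open>k\<close>.\<close>
  define q where "q = (\<lambda>\<epsilon> x. k \<epsilon> x + \<epsilon> * ((1/2) * k2 \<epsilon> x) - (1 + \<epsilon> * k \<epsilon> x) * W x)"
  have "q \<in> unif_smooth"
  proof -
    have "(\<lambda>\<epsilon> x. \<epsilon>) \<in> unif_smooth" "(\<lambda>\<epsilon> x. 1) \<in> unif_smooth"
      by (rule Cinf_unif_const[where B=1]; auto)+
    then show ?thesis unfolding q_def by (intro unif_smooth_intros U W)
  qed
  then obtain Bq where Bq: "Bq \<ge> 0" "\<And>\<epsilon> x. \<epsilon> \<in> {0<..<1} \<Longrightarrow> norm (q \<epsilon> x) \<le> Bq"
    using Cinf_unif_bound by metis
  obtain Bk where Bk: "Bk \<ge> 0" "\<And>\<epsilon> x. \<epsilon> \<in> {0<..<1} \<Longrightarrow> norm (k \<epsilon> x) \<le> Bk"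
    using Cinf_unif_bound[OF U(1)] by metis
  obtain B1 where B1: "B1 \<ge> 0" "\<And>\<epsilon> x. \<epsilon> \<in> {0<..<1} \<Longrightarrow> norm (k1 \<epsilon> x) \<le> B1"
    using Cinf_unif_bound[OF U(2)] by metis
  obtain Bh where Bh: "Bh \<ge> 0" "\<And>\<epsilon> x. \<epsilon> \<in> {0<..<1} \<Longrightarrow> norm (h1 \<epsilon> x) \<le> Bh"
    using Cinf_unif_bound[OF h1(1)] by metis
  define K where "K = 1 + Bq + Bk + B1 + Bh"
  have "K > 0" using Bq(1) Bk(1) B1(1) Bh(1) by (simp add: K_def)
  moreover have "\<exists>g g' d d'.
    (\<forall>x. (g has_real_derivative g' x) (at x)) \<and>
    (\<forall>x. (g' has_real_derivative 2 * (d x + g x * (W x - \<rho>\<^sup>2))) (at x)) \<and>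
    (\<forall>x. (d has_real_derivative d' x) (at x)) \<and>
    (\<forall>x. \<bar>g x - 1\<bar> \<le> K / \<rho>\<^sup>2 \<and> \<bar>g' x\<bar> \<le> K / \<rho>\<^sup>2 \<and> \<bar>d x - \<rho>\<^sup>2\<bar> \<le> K \<and>
      \<bar>g x * (d' x - g' x * (W x - \<rho>\<^sup>2))\<bar> \<le> K / \<rho> ^ (2 * M))" if \<rho>: "\<rho> > 1" for \<rho>
  proof -
    define e where "e = 1 / \<rho>\<^sup>2"
    have e: "e \<in> {0<..<1}" "e * \<rho>\<^sup>2 = 1" "e > 0" using I[OF \<rho>] \<rho> by (auto simp: e_def)
    define g where "g = (\<lambda>x. 1 + e * k e x)"
    define g' where "g' = (\<lambda>x. e * k1 e x)"
    define d where "d = (\<lambda>x. e * k2 e x / 2 - g x * (W x - \<rho>\<^sup>2))"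
    define d' where "d' = (\<lambda>x. e * k3 e x / 2 - (g' x * (W x - \<rho>\<^sup>2) + W' 0 x * g x))"
    have g: "(g has_real_derivative g' x) (at x)" for x
      unfolding g_def g'_def by (auto intro!: derivative_eq_intros d)
    have g': "(g' has_real_derivative e * k2 e x) (at x)" for x
      unfolding g'_def by (auto intro!: derivative_eq_intros d)
    have dd: "(d has_real_derivative d' x) (at x)" for x
      unfolding d_def d'_def by (auto intro!: derivative_eq_intros g k3 W1)
    \<comment> \<open>Differentiating the equation for the approximate amplitude.\<close>
    have key: "g x * (d' x - g' x * (W x - \<rho>\<^sup>2)) = e ^ M * h1 e x" for x
    proof -
      let ?F = "\<lambda>x. e * (g x * (e * k2 e x) / 2 - (g' x)\<^sup>2 / 4 - (g x)\<^sup>2 * W x) + (g x)\<^sup>2"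
      have F1: "(?F has_real_derivative e * (g x * (e * k3 e x) / 2 - 2 * g x * g' x * W x - (g x)\<^sup>2 * W' 0 x)
          + 2 * g x * g' x) (at x)"
        by (rule derivative_eq_intros g g' k3 W1 refl | simp)+ (simp add: algebra_simps power2_eq_square)
      have F2: "?F = (\<lambda>x. 1 + e ^ Suc M * h e x)"
        using eq[of e] unfolding g_def g'_def by auto
      have F3: "((\<lambda>x. 1 + e ^ Suc M * h e x) has_real_derivative e ^ Suc M * h1 e x) (at x)"
        using DERIV_add[OF DERIV_const DERIV_cmult[OF h1(2)]] by simp
      have "e * (g x * (e * k3 e x) / 2 - 2 * g x * g' x * W x - (g x)\<^sup>2 * W' 0 x)
          + 2 * g x * g' x = e ^ Suc M * h1 e x"
        by (rule DERIV_unique[OF F1]) (unfold F2, rule F3)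
      moreover have ring: "e * (g * (e * k / 2 - (g' * (w - r) + w' * g) - g' * (w - r)))
        = e * (g * (e * k) / 2 - 2 * g * g' * w - g\<^sup>2 * w') + 2 * g * g' * (e * r)" for e g g' k w w' r :: real
        by (simp add: field_simps power2_eq_square)
      ultimately have "e * (g x * (d' x - g' x * (W x - \<rho>\<^sup>2))) = e * (e ^ M * h1 e x)"
        unfolding d'_def ring e(2) by simp
      then show ?thesis using e by simp
    qed
    have em: "e ^ M = 1 / \<rho> ^ (2 * M)" by (simp add: e_def power_mult power_one_over)
    have "\<bar>g x - 1\<bar> \<le> K / \<rho>\<^sup>2" for x
    proof -
      have "\<bar>k e x\<bar> \<le> K" using Bk(2)[OF e(1), of x] Bq(1) B1(1) Bh(1) by (simp add: K_def)
      then show ?thesis using e(3) by (simp add: g_def abs_mult) (simp add: e_def divide_right_mono)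
    qed
    moreover have "\<bar>g' x\<bar> \<le> K / \<rho>\<^sup>2" for x
    proof -
      have "\<bar>k1 e x\<bar> \<le> K" using B1(2)[OF e(1), of x] Bq(1) Bk(1) Bh(1) by (simp add: K_def)
      then show ?thesis using e(3) by (simp add: g'_def abs_mult) (simp add: e_def divide_right_mono)
    qed
    moreover have "\<bar>d x - \<rho>\<^sup>2\<bar> \<le> K" for x
    proof -
      have ring: "e * b / 2 - (1 + e * a) * (w - r) - r = a * (e * r) + e * ((1/2) * b) - (1 + e * a) * w"
        for a b r w :: real
        by (simp add: field_simps)
      have "d x - \<rho>\<^sup>2 = q e x" unfolding d_def q_def g_def ring e(2) by simp
      then show ?thesis using Bq(2)[OF e(1), of x] Bk(1) B1(1) Bh(1) by (simp add: K_def)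
    qed
    moreover have "\<bar>g x * (d' x - g' x * (W x - \<rho>\<^sup>2))\<bar> \<le> K / \<rho> ^ (2 * M)" for x
    proof -
      have "\<bar>h1 e x\<bar> \<le> K" using Bh(2)[OF e(1), of x] Bq(1) Bk(1) B1(1) by (simp add: K_def)
      then show ?thesis unfolding key em using \<rho> by (simp add: abs_mult divide_right_mono)
    qed
    moreover have "(g' has_real_derivative 2 * (d x + g x * (W x - \<rho>\<^sup>2))) (at x)" for x
      using g'[of x] by (simp add: d_def)
    ultimately show ?thesis using g dd by blast
  qed
  ultimately show ?thesis by blast
qed

section \<open>Growth of the energy\<close>

text \<open>
  Gronwall's inequality in both directions: \<open>E x * exp (- c x)\<close> decreases and \<open>E x * exp (c x)\<close>
  increases.
\<close>

lemma gronwall_abs: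
  fixes E :: "real \<Rightarrow> real"
  assumes E: "\<And>x. (E has_real_derivative E' x) (at x)" and le: "\<And>x. \<bar>E' x\<bar> \<le> c * E x"
  shows "E b \<le> E a * exp (c * \<bar>b - a\<bar>)"
proof (cases "a \<le> b")
  case True
  have "E b * exp (- c * b) \<le> E a * exp (- c * a)"
  proof (rule DERIV_nonpos_imp_nonincreasing[OF True])
    fix x
    have "((\<lambda>x. E x * exp (- c * x)) has_real_derivative (E' x - c * E x) * exp (- c * x)) (at x)"
      by (auto intro!: derivative_eq_intros E simp: algebra_simps)
    moreover have "(E' x - c * E x) * exp (- c * x) \<le> 0"
      using le[of x] by (intro mult_nonpos_nonneg) auto
    ultimately show "\<exists>y. ((\<lambda>x. E x * exp (- c * x)) has_real_derivative y) (at x) \<and> y \<le> 0" by blast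
  qed
  then have "E b * exp (- c * b) * exp (c * b) \<le> E a * exp (- c * a) * exp (c * b)" by simp
  then show ?thesis using True by (simp add: mult.assoc exp_add[symmetric] algebra_simps)
next
  case False
  have "E b * exp (c * b) \<le> E a * exp (c * a)"
  proof (rule DERIV_nonneg_imp_nondecreasing[where f="\<lambda>x. E x * exp (c * x)"])
    show "b \<le> a" using False by simp
  next
    fix x
    have "((\<lambda>x. E x * exp (c * x)) has_real_derivative (E' x + c * E x) * exp (c * x)) (at x)"
      by (auto intro!: derivative_eq_intros E simp: algebra_simps)
    moreover have "(E' x + c * E x) * exp (c * x) \<ge> 0"
      using le[of x] by (intro mult_nonneg_nonneg) auto
    ultimately show "\<exists>y. ((\<lambda>x. E x * exp (c * x)) has_real_derivative y) (at x) \<and> y \<ge> 0" by blast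
  qed
  then have "E b * exp (c * b) * exp (- c * b) \<le> E a * exp (c * a) * exp (- c * b)" by simp
  then show ?thesis using False by (simp add: mult.assoc exp_add[symmetric] algebra_simps)
qed

lemma mult_one_plus_le:
  fixes a b t :: real
  assumes "0 \<le> a" "0 \<le> b" "0 \<le> t" "t \<le> 1"
  shows "(1 + a * t) * (1 + b * t) \<le> 1 + (a + b + a * b) * t"
proof -
  have "(a * b * t) * t \<le> (a * b * t) * 1" using assms by (intro mult_left_mono) auto
  then show ?thesis by (simp add: algebra_simps)
qed

text \<open>
  Here \<open>X = |v|\<^sup>2\<close>, \<open>Y = Re (cnj v v')\<close> and \<open>Z = |v'|\<^sup>2\<close> in the model case \<open>v'' = (W - \<rho>\<^sup>2) v\<close>. The
  bound is stated for these quantities because they satisfy the same differential equations when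
  \<open>v'\<close> is replaced by a covariant derivative. For large \<open>\<rho>\<close> the almost invariant form, divided by
  \<open>\<rho>\<^sup>2\<close> and called \<open>E\<close> in the proof, differs from \<open>P = X + Z/\<rho>\<^sup>2\<close> by a relative error \<open>O(1/\<rho>)\<close>, and its
  logarithmic derivative is small enough that even over a distance \<open>\<rho> ^ N\<close> it changes only by a factor
  \<open>1 + O(1/\<rho>)\<close>. For bounded \<open>\<rho>\<close> the distances are bounded, so a plain Gronwall argument
  for \<open>P\<close> gives a constant factor, which suffices since \<open>1/\<rho>\<close> is bounded below.
\<close>

lemma covariant_energy_bound:
  fixes W :: "real \<Rightarrow> real" and N :: nat
  assumes W: "(\<lambda>\<epsilon>. W) \<in> unif_smooth"
  shows "\<exists>C\<ge>0. \<forall>\<rho>>1. \<forall>X Y Z.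
    (\<forall>x. (X has_real_derivative 2 * Y x) (at x) \<and>
         (Y has_real_derivative Z x + (W x - \<rho>\<^sup>2) * X x) (at x) \<and>
         (Z has_real_derivative 2 * (W x - \<rho>\<^sup>2) * Y x) (at x) \<and>
         0 \<le> X x \<and> 0 \<le> Z x \<and> (Y x)\<^sup>2 \<le> X x * Z x) \<longrightarrow>
    (\<forall>a b. \<bar>b - a\<bar> \<le> \<rho> ^ N \<longrightarrow>
       X b + Z b / \<rho>\<^sup>2 \<le> (1 + C / \<rho>) * (X a + Z a / \<rho>\<^sup>2))"
proof -
  obtain K where K: "K > 0" and form: "\<And>\<rho>. \<rho> > 1 \<Longrightarrow> \<exists>g g' d d'.
    (\<forall>x. (g has_real_derivative g' x) (at x)) \<and>
    (\<forall>x. (g' has_real_derivative 2 * (d x + g x * (W x - \<rho>\<^sup>2))) (at x)) \<and>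
    (\<forall>x. (d has_real_derivative d' x) (at x)) \<and>
    (\<forall>x. \<bar>g x - 1\<bar> \<le> K / \<rho>\<^sup>2 \<and> \<bar>g' x\<bar> \<le> K / \<rho>\<^sup>2 \<and> \<bar>d x - \<rho>\<^sup>2\<bar> \<le> K \<and>
      \<bar>g x * (d' x - g' x * (W x - \<rho>\<^sup>2))\<bar> \<le> K / \<rho> ^ (2 * N))"
    using almost_invariant_form[OF W, of N] by blast
  have "\<exists>B\<ge>0. \<forall>x. \<bar>W x\<bar> \<le> B"
  proof -
    obtain B where "B \<ge> 0" "\<And>\<epsilon> x. \<epsilon> \<in> {0<..<1::real} \<Longrightarrow> norm (W x) \<le> B"
      using Cinf_unif_bound[OF W] by metis
    from this(1) this(2)[of "1/2"] show ?thesis by auto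
  qed
  then obtain B where B: "B \<ge> 0" "\<And>x. \<bar>W x\<bar> \<le> B" by blast
  \<comment> \<open>Beyond \<open>\<rho>0\<close> one has \<open>4 K / \<rho> \<le> 1\<close>, so that the almost invariant form is comparable to the energy.
    The constant \<open>C1\<close> serves \<open>\<rho> < \<rho>0\<close>. The constant \<open>C3\<close> serves \<open>\<rho> \<ge> \<rho>0\<close> and collects the factors
    \<open>1 + 2 K / \<rho>\<close> and \<open>1 + 4 K / \<rho>\<close> (through \<open>C2\<close>) for passing from \<open>P\<close> to \<open>E\<close> and back,
    and \<open>1 + 8 K / \<rho>\<close> for the growth of \<open>E\<close>.\<close>
  define \<rho>0 where "\<rho>0 = 4 * K + 1"
  have \<rho>0: "\<rho>0 > 0" using K by (simp add: \<rho>0_def)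
  define C1 where "C1 = exp (B * \<rho>0 ^ N) * \<rho>0"
  define C2 where "C2 = 2 * K + 4 * K + 2 * K * (4 * K)"
  define C3 where "C3 = 8 * K + C2 + 8 * K * C2"
  have C: "C1 \<ge> 0" "C2 \<ge> 0" "C3 \<ge> 0" using K \<rho>0 by (auto simp: C1_def C2_def C3_def)
  have bound: "X b + Z b / \<rho>\<^sup>2 \<le> (1 + (C1 + C3) / \<rho>) * (X a + Z a / \<rho>\<^sup>2)"
    if \<rho>: "\<rho> > 1" and sys: "\<And>x. (X has_real_derivative 2 * Y x) (at x)"
         "\<And>x. (Y has_real_derivative Z x + (W x - \<rho>\<^sup>2) * X x) (at x)"
         "\<And>x. (Z has_real_derivative 2 * (W x - \<rho>\<^sup>2) * Y x) (at x)"
      and pos: "\<And>x. 0 \<le> X x" "\<And>x. 0 \<le> Z x" "\<And>x. (Y x)\<^sup>2 \<le> X x * Z x"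
      and ab: "\<bar>b - a\<bar> \<le> \<rho> ^ N" for \<rho> X Y Z a b
  proof -
    define P where "P = (\<lambda>x. X x + Z x / \<rho>\<^sup>2)"
    define t where "t = 1 / \<rho>"
    have t: "0 < t" "t \<le> 1" using \<rho> by (auto simp: t_def)
    have P0: "P x \<ge> 0" for x using pos \<rho> by (simp add: P_def)
    have XP: "X x \<le> P x" for x using pos \<rho> by (simp add: P_def)
    \<comment> \<open>By the arithmetic-geometric mean inequality for \<open>\<rho> X\<close> and \<open>Z / \<rho>\<close>.\<close>
    have YP: "2 * \<bar>Y x\<bar> \<le> \<rho> * P x" for x
    proof -
      have "(2 * \<bar>Y x\<bar>)\<^sup>2 \<le> 4 * (X x * Z x)" using pos(3)[of x] by (simp add: power_mult_distrib)
      also have "\<dots> \<le> (\<rho> * X x + Z x / \<rho>)\<^sup>2"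
      proof -
        have "(\<rho> * X x + Z x / \<rho>)\<^sup>2 - 4 * (X x * Z x) = (\<rho> * X x - Z x / \<rho>)\<^sup>2"
          using \<rho> by (simp add: power2_eq_square field_simps)
        then show ?thesis using zero_le_power2[of "\<rho> * X x - Z x / \<rho>"] by linarith
      qed
      finally have "2 * \<bar>Y x\<bar> \<le> \<rho> * X x + Z x / \<rho>"
        using \<rho> pos by (intro power2_le_imp_le[of "2 * \<bar>Y x\<bar>"]) auto
      also have "\<dots> = \<rho> * P x" using \<rho> by (simp add: P_def field_simps power2_eq_square)
      finally show ?thesis .
    qed
    have "P b \<le> (1 + (C1 + C3) * t) * P a"
    proof (cases "\<rho> < \<rho>0")
      case True
      have "\<bar>2 * W x * Y x / \<rho>\<^sup>2\<bar> \<le> B * P x" for x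
      proof -
        have "\<bar>2 * W x * Y x\<bar> = \<bar>W x\<bar> * (2 * \<bar>Y x\<bar>)" by (simp add: abs_mult)
        also have "\<dots> \<le> B * (\<rho> * P x)" by (intro mult_mono B YP) auto
        also have "\<dots> \<le> B * (\<rho>\<^sup>2 * P x)" using B P0 \<rho>
          by (intro mult_left_mono mult_right_mono) (auto simp: power2_eq_square)
        finally show ?thesis using \<rho> by (simp add: abs_divide field_simps)
      qed
      moreover have "(P has_real_derivative 2 * W x * Y x / \<rho>\<^sup>2) (at x)" for x
        unfolding P_def using \<rho>
        by (auto intro!: derivative_eq_intros sys simp: field_simps)
      ultimately have "P b \<le> P a * exp (B * \<bar>b - a\<bar>)" by (intro gronwall_abs)
      also have "\<dots> \<le> P a * exp (B * \<rho>0 ^ N)"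
      proof -
        have "\<rho> ^ N \<le> \<rho>0 ^ N" using True \<rho> by (intro power_mono) auto
        then show ?thesis using ab P0 B by (intro mult_left_mono) (auto intro!: mult_left_mono)
      qed
      also have "\<dots> \<le> (1 + (C1 + C3) * t) * P a"
      proof -
        have "exp (B * \<rho>0 ^ N) \<le> exp (B * \<rho>0 ^ N) * (\<rho>0 * t)"
          using True \<rho> by (intro mult_le_cancel_left1[THEN iffD2]) (auto simp: t_def)
        also have "\<dots> = C1 * t" by (simp add: C1_def)
        also have "\<dots> \<le> 1 + (C1 + C3) * t" using C t by (simp add: algebra_simps)
        finally have "exp (B * \<rho>0 ^ N) \<le> 1 + (C1 + C3) * t" .
        from mult_right_mono[OF this P0[of a]] show ?thesis by (subst mult.commute)
      qed
      finally show ?thesis .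
    next
      case False
      have Kt: "4 * K * t \<le> 1" using False \<rho> by (simp add: t_def \<rho>0_def field_simps)
      have tt: "t\<^sup>2 \<le> t" using t by (simp add: power2_eq_square mult_left_le)
      have rt: "\<rho> * t = 1" "1 / \<rho>\<^sup>2 = t\<^sup>2" using \<rho> by (auto simp: t_def power_one_over)
      obtain g g' d d' where g: "\<forall>x. (g has_real_derivative g' x) (at x)"
        and g': "\<forall>x. (g' has_real_derivative 2 * (d x + g x * (W x - \<rho>\<^sup>2))) (at x)"
        and d: "\<forall>x. (d has_real_derivative d' x) (at x)"
        and bds: "\<forall>x. \<bar>g x - 1\<bar> \<le> K / \<rho>\<^sup>2 \<and> \<bar>g' x\<bar> \<le> K / \<rho>\<^sup>2 \<and> \<bar>d x - \<rho>\<^sup>2\<bar> \<le> K \<and>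
          \<bar>g x * (d' x - g' x * (W x - \<rho>\<^sup>2))\<bar> \<le> K / \<rho> ^ (2 * N)"
        using form[OF \<rho>] by (elim exE conjE) (rule that)
      note g = g[rule_format] and g' = g'[rule_format] and d = d[rule_format]
      have bds: "\<bar>g x - 1\<bar> \<le> K / \<rho>\<^sup>2" "\<bar>g' x\<bar> \<le> K / \<rho>\<^sup>2" "\<bar>d x - \<rho>\<^sup>2\<bar> \<le> K"
          "\<bar>g x * (d' x - g' x * (W x - \<rho>\<^sup>2))\<bar> \<le> K / \<rho> ^ (2 * N)" for x
        using bds by simp_all
      define E where "E = (\<lambda>x. (g x * Z x - g' x * Y x + d x * X x) / \<rho>\<^sup>2)"
      define r where "r = (\<lambda>x. d' x - g' x * (W x - \<rho>\<^sup>2))"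
      have dE: "(E has_real_derivative r x * X x / \<rho>\<^sup>2) (at x)" for x
        unfolding E_def r_def
        by (rule DERIV_cong[OF DERIV_cdivide[OF DERIV_add[OF
                DERIV_diff[OF DERIV_mult[OF g sys(3)] DERIV_mult[OF g' sys(2)]] DERIV_mult[OF d sys(1)]]]])
          (simp add: algebra_simps)
      have EP: "\<bar>E x - P x\<bar> \<le> 2 * K * t * P x" for x
      proof -
        have "E x - P x = ((g x - 1) * Z x - g' x * Y x + (d x - \<rho>\<^sup>2) * X x) / \<rho>\<^sup>2"
          using \<rho> by (simp add: E_def P_def field_simps)
        also have "\<bar>\<dots>\<bar> \<le> (\<bar>g x - 1\<bar> * Z x + \<bar>g' x\<bar> * \<bar>Y x\<bar> + \<bar>d x - \<rho>\<^sup>2\<bar> * X x) / \<rho>\<^sup>2"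
        proof -
          have "\<bar>(g x - 1) * Z x\<bar> = \<bar>g x - 1\<bar> * Z x" "\<bar>(d x - \<rho>\<^sup>2) * X x\<bar> = \<bar>d x - \<rho>\<^sup>2\<bar> * X x"
            "\<bar>g' x * Y x\<bar> = \<bar>g' x\<bar> * \<bar>Y x\<bar>" using pos by (auto simp: abs_mult)
          then show ?thesis unfolding abs_divide abs_power2
            by (intro divide_right_mono zero_le_power2) linarith
        qed
        also have "\<dots> \<le> (K / \<rho>\<^sup>2 * Z x + K / \<rho>\<^sup>2 * \<bar>Y x\<bar> + K * X x) / \<rho>\<^sup>2"
          by (intro divide_right_mono add_mono mult_right_mono bds pos) auto
        also have "\<dots> = K * t\<^sup>2 * (P x + t * (t * \<bar>Y x\<bar>))"
          using \<rho> by (simp add: P_def t_def field_simps power2_eq_square)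
        also have "\<dots> \<le> K * t * (P x + 1 * P x)"
        proof (intro mult_mono add_mono)
          have "t * (2 * \<bar>Y x\<bar>) \<le> t * (\<rho> * P x)" using YP t by (intro mult_left_mono) auto
          also have "\<dots> = P x" using rt by (simp add: mult.assoc[symmetric] mult.commute)
          finally have "t * \<bar>Y x\<bar> + t * \<bar>Y x\<bar> \<le> P x" by simp
          then show "t * \<bar>Y x\<bar> \<le> P x" using t mult_nonneg_nonneg[of t "\<bar>Y x\<bar>"] by linarith
        qed (use K t tt P0 in \<open>auto intro!: add_nonneg_nonneg mult_nonneg_nonneg\<close>)
        finally show ?thesis by simp
      qed
      have KtP: "4 * K * t * P x \<le> P x" for x using mult_right_mono[OF Kt P0[of x]] by simp
      have PE: "P x \<le> 2 * E x" for x using EP[of x] KtP[of x] by (simp add: abs_le_iff)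
      have "\<bar>r x * X x / \<rho>\<^sup>2\<bar> \<le> (4 * K * t * (1 / \<rho> ^ N)) * E x" for x
      proof -
        have "\<bar>r x\<bar> \<le> 2 * (K / \<rho> ^ (2 * N))"
        proof -
          have "K / \<rho>\<^sup>2 \<le> 1 / 4"
          proof -
            have "K / \<rho>\<^sup>2 = K * t\<^sup>2" using rt(2) by (simp add: divide_inverse)
            also have "\<dots> \<le> K * t" using K tt by simp
            also have "\<dots> \<le> 1 / 4" using Kt by simp
            finally show ?thesis .
          qed
          then have "g x \<ge> 1 / 2" using bds(1)[of x] by linarith
          then have "1 / 2 * \<bar>r x\<bar> \<le> \<bar>g x\<bar> * \<bar>r x\<bar>" by (intro mult_right_mono) auto
          then show ?thesis using bds(4)[of x] by (simp add: r_def abs_mult)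
        qed
        moreover have "X x \<le> 2 * E x" using XP PE order_trans by blast
        ultimately have "\<bar>r x\<bar> * X x \<le> 2 * (K / \<rho> ^ (2 * N)) * (2 * E x)"
          using pos K \<rho> by (intro mult_mono) auto
        then have "\<bar>r x\<bar> * X x / \<rho>\<^sup>2 \<le> 2 * (K / \<rho> ^ (2 * N)) * (2 * E x) / \<rho>\<^sup>2"
          by (intro divide_right_mono) auto
        also have "\<dots> = 4 * K * E x * (1 / \<rho>\<^sup>2 * (1 / \<rho> ^ (2 * N)))"
          by (simp add: mult_ac)
        also have "\<dots> \<le> 4 * K * E x * (t * (1 / \<rho> ^ N))"
        proof (intro mult_left_mono mult_mono)
          show "1 / \<rho>\<^sup>2 \<le> t" using rt(2) tt by simp
          show "1 / \<rho> ^ (2 * N) \<le> 1 / \<rho> ^ N"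
            using \<rho> by (intro divide_left_mono power_increasing) auto
        qed (use K t \<rho> P0[of x] PE[of x] in auto)
        finally have "\<bar>r x\<bar> * X x / \<rho>\<^sup>2 \<le> 4 * K * E x * (t * (1 / \<rho> ^ N))" .
        moreover have abs_eq: "\<bar>r x * X x / \<rho>\<^sup>2\<bar> = \<bar>r x\<bar> * X x / \<rho>\<^sup>2"
          using pos(1)[of x] by (simp add: abs_mult)
        ultimately show ?thesis unfolding abs_eq by (simp add: mult_ac)
      qed
      from gronwall_abs[OF dE this]
      have "E b \<le> E a * exp (4 * K * t * (1 / \<rho> ^ N) * \<bar>b - a\<bar>)" .
      also have "\<dots> \<le> E a * exp (4 * K * t)"
      proof -
        have "4 * K * t * (1 / \<rho> ^ N * \<bar>b - a\<bar>) \<le> 4 * K * t * 1"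
          using ab K t \<rho> by (intro mult_left_mono) (auto simp: field_simps)
        then show ?thesis using P0[of a] PE[of a] by (intro mult_left_mono) (auto simp: mult.assoc)
      qed
      also have "\<dots> \<le> E a * (1 + 8 * K * t)"
      proof -
        have "exp (4 * K * t) \<le> 1 + 4 * K * t + (4 * K * t)\<^sup>2"
          using Kt K t by (intro exp_bound) auto
        also have "(4 * K * t)\<^sup>2 \<le> 4 * K * t"
          using Kt K t by (auto simp: power2_eq_square intro!: mult_left_le)
        finally show ?thesis using P0[of a] PE[of a] by (intro mult_left_mono) auto
      qed
      finally have Eb: "E b \<le> E a * (1 + 8 * K * t)" .
      have "P b \<le> (1 + 4 * K * t) * E b"
      proof -
        have "1 \<le> (1 + 4 * K * t) * (1 - 2 * K * t)"
        proof -
          have "2 * K * t * (4 * K * t) \<le> 2 * K * t * 1" using Kt K t by (intro mult_left_mono) auto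
          then show ?thesis by (simp add: algebra_simps)
        qed
        then have "P b \<le> (1 + 4 * K * t) * (1 - 2 * K * t) * P b"
          using mult_right_mono[OF _ P0[of b]] by fastforce
        also have "\<dots> = (1 + 4 * K * t) * ((1 - 2 * K * t) * P b)" by simp
        also have "\<dots> \<le> (1 + 4 * K * t) * E b"
          using EP[of b] K t by (intro mult_left_mono) (auto simp: abs_le_iff algebra_simps)
        finally show ?thesis .
      qed
      also have "\<dots> \<le> (1 + 4 * K * t) * ((1 + 2 * K * t) * P a * (1 + 8 * K * t))"
      proof (intro mult_left_mono order_trans[OF Eb] mult_right_mono)
        show "E a \<le> (1 + 2 * K * t) * P a" using EP[of a] by (simp add: abs_le_iff algebra_simps)
      qed (use K t in auto)
      also have "\<dots> = ((1 + 8 * K * t) * ((1 + 2 * K * t) * (1 + 4 * K * t))) * P a" by simp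
      also have "\<dots> \<le> (1 + C3 * t) * P a"
      proof (intro mult_right_mono P0)
        have "(1 + 8 * K * t) * ((1 + 2 * K * t) * (1 + 4 * K * t)) \<le> (1 + 8 * K * t) * (1 + C2 * t)"
          using mult_one_plus_le[of "2 * K" "4 * K" t] K t by (intro mult_left_mono) (auto simp: C2_def)
        also have "\<dots> \<le> 1 + C3 * t"
          using mult_one_plus_le[of "8 * K" C2 t] K t C by (simp add: C3_def)
        finally show "(1 + 8 * K * t) * ((1 + 2 * K * t) * (1 + 4 * K * t)) \<le> 1 + C3 * t" .
      qed
      also have "\<dots> \<le> (1 + (C1 + C3) * t) * P a"
        using C t P0 by (intro mult_right_mono) (auto simp: algebra_simps)
      finally show ?thesis .
    qed
    then show ?thesis by (simp add: P_def t_def)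
  qed
  show ?thesis
  proof (intro exI[of _ "C1 + C3"] conjI allI impI, goal_cases)
    case 1
    show ?case using C by simp
  next
    case (2 \<rho> X Y Z a b)
    from 2(2) show ?case by (intro bound[OF 2(1), of X Y Z b a] 2(3)) blast+
  qed
qed

text \<open>
  Replacing \<open>u'\<close> by the covariant derivative \<open>u' + \<i> A u\<close> changes the energy by a relative error
  \<open>O(1/\<rho>)\<close>, because \<open>u\<close> enters the energy with a weight \<open>\<rho>\<close> times that of the derivative. Applied with
  \<open>A\<close> and with \<open>-A\<close> the lemma compares the two energies in both directions.
\<close>

lemma energy_shift_le:
  fixes u z :: complex and A c \<rho> :: real
  assumes \<rho>: "\<rho> > 1" and A: "\<bar>A\<bar> \<le> c"
  shows "(cmod u)\<^sup>2 + (cmod (z + \<i> * of_real A * u))\<^sup>2 / \<rho>\<^sup>2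
    \<le> (1 + (c\<^sup>2 + c) / \<rho>) * ((cmod u)\<^sup>2 + (cmod z)\<^sup>2 / \<rho>\<^sup>2)"
proof -
  define p q where "p = cmod u" and "q = cmod z / \<rho>"
  have c: "c \<ge> 0" using A by simp
  have pq: "p \<ge> 0" "q \<ge> 0" using \<rho> by (auto simp: p_def q_def)
  have "cmod (z + \<i> * of_real A * u) / \<rho> \<le> (cmod z + c * p) / \<rho>"
  proof (rule divide_right_mono)
    have "cmod (z + \<i> * of_real A * u) \<le> cmod z + \<bar>A\<bar> * p"
      using norm_triangle_ineq[of z "\<i> * of_real A * u"] by (simp add: norm_mult p_def)
    also have "\<dots> \<le> cmod z + c * p" using A pq by (intro add_left_mono mult_right_mono)
    finally show "cmod (z + \<i> * of_real A * u) \<le> cmod z + c * p" .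
  qed (use \<rho> in simp)
  also have "\<dots> = q + c * p / \<rho>" by (simp add: q_def add_divide_distrib)
  finally have "(cmod (z + \<i> * of_real A * u) / \<rho>)\<^sup>2 \<le> (q + c * p / \<rho>)\<^sup>2"
    using \<rho> by (intro power_mono) auto
  also have "\<dots> = q\<^sup>2 + c / \<rho> * (2 * p * q) + c\<^sup>2 / \<rho>\<^sup>2 * p\<^sup>2"
    using \<rho> by (simp add: power2_eq_square field_simps)
  also have "\<dots> \<le> q\<^sup>2 + c / \<rho> * (p\<^sup>2 + q\<^sup>2) + c\<^sup>2 / \<rho> * (p\<^sup>2 + q\<^sup>2)"
  proof (intro add_mono mult_mono order_refl)
    show "2 * p * q \<le> p\<^sup>2 + q\<^sup>2" using sum_squares_bound[of p q] by simp
    show "c\<^sup>2 / \<rho>\<^sup>2 \<le> c\<^sup>2 / \<rho>" using \<rho> by (intro divide_left_mono) (auto simp: power2_eq_square)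
  qed (use c \<rho> pq in auto)
  finally show ?thesis
    by (simp add: p_def q_def power_divide algebra_simps add_divide_distrib)
qed

theorem corollary1p20:
  fixes Q :: "(real \<Rightarrow> complex) \<Rightarrow> real \<Rightarrow> complex" and N :: nat
  assumes "Q \<in> Diff1" and "formally_self_adjoint Q"
  shows "\<exists>C::real. \<forall>\<rho>::real. \<rho> > 1 \<longrightarrow>
           (\<forall>u. solves Q \<rho> u \<and> (\<exists>x. u x \<noteq> 0) \<longrightarrow>
             (\<forall>a b::real. \<bar>b - a\<bar> \<le> \<rho> ^ N \<longrightarrow>
               ED \<rho> u b / ED \<rho> u a < 1 + C * \<rho> powi (-1)))"
proof -
  obtain a\<^sub>1 a\<^sub>0 where sb: "smooth_bounded a\<^sub>1" "smooth_bounded a\<^sub>0"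
    and Q: "Q = (\<lambda>u x. a\<^sub>1 x * D_op u x + a\<^sub>0 x * u x)"
    using assms(1) by (auto simp: Diff1_def)
  have da1: "(a\<^sub>1 has_vector_derivative ddx a\<^sub>1 x) (at x)" for x
    using sb(1) unfolding smooth_bounded_def smooth_def
    by (metis funpow_0 vector_derivative_works)
  have "(ddx ^^ 1) a\<^sub>1 differentiable (at x)" for x
    using sb(1) unfolding smooth_bounded_def smooth_def by blast
  then have ca1: "continuous_on UNIV (ddx a\<^sub>1)"
    by (simp add: continuous_at_imp_continuous_on differentiable_imp_continuous_within)
  have "(ddx ^^ 0) a\<^sub>0 differentiable (at x)" for x
    using sb(2) unfolding smooth_bounded_def smooth_def by blast
  then have ca0: "continuous_on UNIV a\<^sub>0"
    by (simp add: continuous_at_imp_continuous_on differentiable_imp_continuous_within)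
  note coeffs = self_adjoint_coefficients[OF assms(2)[unfolded Q] da1 ca1 ca0]
  define A where "A = (\<lambda>x. (1/2) * Re (a\<^sub>1 x))"
  define W where "W = (\<lambda>x. Re (a\<^sub>0 x) - A x * A x)"
  have a1_A: "a\<^sub>1 x = 2 * of_real (A x)" for x
    using coeffs(1) by (simp add: A_def complex_eq_iff)
  have As: "(\<lambda>\<epsilon>. A) \<in> unif_smooth"
    using Cinf_unif_cmult[OF Cinf_Re[OF smooth_bounded_Cinf[OF sb(1)]], of "1/2"] by (simp add: A_def)
  have Ws: "(\<lambda>\<epsilon>. W) \<in> unif_smooth"
    unfolding W_def by (intro unif_smooth_intros As Cinf_Re smooth_bounded_Cinf sb)
  obtain c where c: "\<And>x. \<bar>A x\<bar> \<le> c"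
  proof -
    obtain c where "\<And>\<epsilon> x. \<epsilon> \<in> {0<..<1::real} \<Longrightarrow> norm (A x) \<le> c"
      using Cinf_unif_bound[OF As] by metis
    from this[of "1/2"] show ?thesis by (intro that[of c]) auto
  qed
  have "c \<ge> 0" using c[of 0] by simp
  obtain C where "C \<ge> 0" and C: "\<And>\<rho> X Y Z a b. \<rho> > 1 \<Longrightarrow>
    (\<forall>x. (X has_real_derivative 2 * Y x) (at x) \<and>
         (Y has_real_derivative Z x + (W x - \<rho>\<^sup>2) * X x) (at x) \<and>
         (Z has_real_derivative 2 * (W x - \<rho>\<^sup>2) * Y x) (at x) \<and>
         0 \<le> X x \<and> 0 \<le> Z x \<and> (Y x)\<^sup>2 \<le> X x * Z x) \<Longrightarrow> \<bar>b - a\<bar> \<le> \<rho> ^ N \<Longrightarrow>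
       X b + Z b / \<rho>\<^sup>2 \<le> (1 + C / \<rho>) * (X a + Z a / \<rho>\<^sup>2)"
    using covariant_energy_bound[OF Ws, of N] by blast
  define L where "L = c\<^sup>2 + c"
  define L2 where "L2 = L + L + L * L"
  define C' where "C' = L2 + C + L2 * C"
  have L: "L \<ge> 0" "L2 \<ge> 0" "C' \<ge> 0" using \<open>c \<ge> 0\<close> \<open>C \<ge> 0\<close> by (auto simp: L_def L2_def C'_def)
  have "ED \<rho> u b / ED \<rho> u a < 1 + (C' + 1) * \<rho> powi (-1)"
    if \<rho>: "\<rho> > 1" and u: "solves Q \<rho> u" and ab: "\<bar>b - a\<bar> \<le> \<rho> ^ N" for \<rho> u a b
  proof -
    define t where "t = 1 / \<rho>"
    have t: "0 < t" "t \<le> 1" using \<rho> by (auto simp: t_def)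
    \<comment> \<open>The covariant derivative. In terms of it the equation reads
      \<open>w' + \<i> A w = (W - \<rho>\<^sup>2) u\<close>: the relation \<open>Im a\<^sub>0 = - A'\<close> cancels the
      imaginary part of the zeroth order coefficient.\<close>
    define w where "w = (\<lambda>x. ddx u x + \<i> * of_real (A x) * u x)"
    have du: "(u has_vector_derivative w x - \<i> * of_real (A x) * u x) (at x)" for x
      using u by (simp add: w_def solves_def vector_derivative_works[symmetric])
    have ddu: "(ddx u has_vector_derivative ddx (ddx u) x) (at x)" for x
      using u by (simp add: solves_def vector_derivative_works[symmetric])
    have dA: "((\<lambda>x. complex_of_real (A x)) has_vector_derivative of_real (- Im (a\<^sub>0 x))) (at x)" for x
    proof -
      have "((\<lambda>x. (1/2) * Re (a\<^sub>1 x)) has_vector_derivative (1/2) * Re (ddx a\<^sub>1 x)) (at x)"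
        by (intro has_vector_derivative_mult_right bounded_linear.has_vector_derivative[OF bounded_linear_Re] da1)
      from bounded_linear.has_vector_derivative[OF bounded_linear_of_real[where 'a=complex] this]
      show ?thesis by (simp add: A_def coeffs(2))
    qed
    have dw: "(w has_vector_derivative of_real (W x - \<rho>\<^sup>2) * u x - \<i> * of_real (A x) * w x) (at x)" for x
    proof -
      have "(w has_vector_derivative ddx (ddx u) x + (\<i> * of_real (A x) * (w x - \<i> * of_real (A x) * u x)
          + \<i> * of_real (- Im (a\<^sub>0 x)) * u x)) (at x)"
        unfolding w_def[abs_def]
        by (intro has_vector_derivative_add ddu has_vector_derivative_mult has_vector_derivative_mult_right dA
            du[unfolded w_def])
      moreover have "ddx (ddx u) x = 2 * of_real (A x) * (- \<i> * (w x - \<i> * of_real (A x) * u x))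
          + (of_real (W x) + of_real (A x) * of_real (A x) + \<i> * of_real (Im (a\<^sub>0 x))) * u x
          - of_real (\<rho>\<^sup>2) * u x"
      proof -
        have eqn: "- ddx (ddx u) x + (a\<^sub>1 x * (- \<i> * ddx u x) + a\<^sub>0 x * u x) = of_real (\<rho>\<^sup>2) * u x"
          using u by (simp add: solves_def Q D_op_def)
        have du': "w x - \<i> * of_real (A x) * u x = ddx u x" by (simp add: w_def)
        have a0: "of_real (W x) + of_real (A x) * of_real (A x) + \<i> * of_real (Im (a\<^sub>0 x)) = a\<^sub>0 x"
          by (simp add: W_def complex_eq_iff)
        show ?thesis unfolding du' a0 a1_A[symmetric] eqn[symmetric] by simp
      qed
      ultimately show ?thesis
        by (elim has_vector_derivative_eq_rhs) (simp add: algebra_simps)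
    qed
    \<comment> \<open>The connection terms \<open>\<i> A\<close> are skew and drop out of the derivatives of these
      gauge invariant quantities.\<close>
    define X where "X = (\<lambda>x. (cmod (u x))\<^sup>2)"
    define Y where "Y = (\<lambda>x. Re (u x) * Re (w x) + Im (u x) * Im (w x))"
    define Z where "Z = (\<lambda>x. (cmod (w x))\<^sup>2)"
    have ReIm: "((\<lambda>x. Re (f x)) has_real_derivative Re f') (at x)"
       "((\<lambda>x. Im (f x)) has_real_derivative Im f') (at x)"
      if "(f has_vector_derivative f') (at x)" for f f' x
      using that by (auto simp: has_vector_derivative_complex_iff)
    note RI = ReIm[OF du] ReIm[OF dw]
    have "(X has_real_derivative 2 * Y x) (at x)" for x
      unfolding X_def cmod_power2
      by (rule RI derivative_eq_intros refl)+ (simp add: Y_def algebra_simps)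
    moreover have "(Y has_real_derivative Z x + (W x - \<rho>\<^sup>2) * X x) (at x)" for x
      unfolding Y_def
      by (rule RI derivative_eq_intros refl)+
        (unfold Z_def X_def cmod_power2, simp add: power2_eq_square algebra_simps)
    moreover have "(Z has_real_derivative 2 * (W x - \<rho>\<^sup>2) * Y x) (at x)" for x
      unfolding Z_def cmod_power2
      by (rule RI derivative_eq_intros refl)+ (simp add: Y_def power2_eq_square algebra_simps)
    moreover have "(Y x)\<^sup>2 \<le> X x * Z x" for x
    proof -
      have "\<bar>Y x\<bar> \<le> cmod (u x) * cmod (w x)"
        using abs_Re_le_cmod[of "cnj (u x) * w x"] by (simp add: Y_def norm_mult)
      from power_mono[OF this, of 2] show ?thesis by (simp add: X_def Z_def power_mult_distrib)
    qed
    ultimately have main: "X b + Z b / \<rho>\<^sup>2 \<le> (1 + C * t) * (X a + Z a / \<rho>\<^sup>2)"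
      using C[OF \<rho> _ ab, of X Y Z] by (simp add: X_def Z_def t_def)
    have ED: "ED \<rho> u x = (cmod (u x))\<^sup>2 + (cmod (ddx u x))\<^sup>2 / \<rho>\<^sup>2" for x
      by (simp add: ED_def power_int_def divide_inverse power_inverse mult.commute)
    have ED0: "ED \<rho> u x \<ge> 0" for x by (simp add: ED)
    have "ED \<rho> u b \<le> (1 + L * t) * (X b + Z b / \<rho>\<^sup>2)"
      using energy_shift_le[OF \<rho>, of "- A b" c "u b" "w b"] c[of b]
      by (simp add: ED X_def Z_def L_def t_def w_def)
    also have "\<dots> \<le> (1 + L * t) * ((1 + C * t) * ((1 + L * t) * ED \<rho> u a))"
    proof (intro mult_left_mono order_trans[OF main])
      show "X a + Z a / \<rho>\<^sup>2 \<le> (1 + L * t) * ED \<rho> u a"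
        using energy_shift_le[OF \<rho>, of "A a" c "u a" "ddx u a"] c[of a]
        by (simp add: ED X_def Z_def L_def t_def w_def)
    qed (use L t \<open>C \<ge> 0\<close> in auto)
    also have "\<dots> = ((1 + L * t) * (1 + L * t)) * (1 + C * t) * ED \<rho> u a" by simp
    also have "\<dots> \<le> (1 + C' * t) * ED \<rho> u a"
    proof (intro mult_right_mono ED0)
      have "(1 + L * t) * (1 + L * t) * (1 + C * t) \<le> (1 + L2 * t) * (1 + C * t)"
        using mult_one_plus_le[of L L t] L t \<open>C \<ge> 0\<close> by (intro mult_right_mono) (auto simp: L2_def)
      also have "\<dots> \<le> 1 + C' * t"
        using mult_one_plus_le[of L2 C t] L t \<open>C \<ge> 0\<close> by (simp add: C'_def)
      finally show "(1 + L * t) * (1 + L * t) * (1 + C * t) \<le> 1 + C' * t" .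
    qed
    finally have bound: "ED \<rho> u b \<le> (1 + C' * t) * ED \<rho> u a" .
    have "ED \<rho> u b / ED \<rho> u a \<le> 1 + C' * t"
    \<comment> \<open>A vanishing denominator makes the quotient zero by convention.\<close>
    proof (cases "ED \<rho> u a = 0")
      case True
      then show ?thesis using L t by simp
    next
      case False
      then have "ED \<rho> u a > 0" using ED0[of a] by simp
      then show ?thesis using bound by (simp add: divide_le_eq)
    qed
    also have "\<dots> < 1 + (C' + 1) * t" using t by (simp add: algebra_simps)
    finally show ?thesis by (simp add: t_def power_int_def divide_inverse)
  qed
  then show ?thesis by blast
qed

end
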